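(* Let $f,g\in\mathcal B_1(2^\omega)\setminus\mathcal B_0(2^\omega)$. Then $f\le_{\mathbf{tt}} g$ if and only if $|f|_\alpha\lesssim|g|_\alpha$.
   Context: $\mathcal B_0(2^\omega)$: continuous functions $2^\omega\to\mathbb R$; $\mathcal B_1(2^\omega)$: pointwise limits of sequences of continuous functions. Optimal derivation sequence: for $\mathcal C\subseteq\mathcal P(X)$, $X$ a compact metric space, define $P^0=X$, $P^{\nu+1}=P^\nu\setminus\bigcup\{U\subseteq X \text{ open}: P^\nu\cap U\subseteq C\text{ for some }C\in\mathcal C\}$, and $P^\lambda=\bigcap_{\nu<\lambda}P^\nu$ for limit $\lambda$. Bourgain rank: for $f\in\mathcal B_1(2^\omega)$, $p\in\mathbb Q$, $\varepsilon\in\mathbb Q^+$, let $P^\nu_{f,p,\varepsilon}$ be the optimal derivation sequence for $\{f^{-1}((-\infty,p+\varepsilon)),f^{-1}((p-\varepsilon,\infty))\}$, let $\alpha(f,p,\varepsilon)$ be the least $\nu$ with $P^\nu_{f,p,\varepsilon}=\emptyset$, and $|f|_\alpha=\sup_{p,\varepsilon}\alpha(f,p,\varepsilon)$. Ordinal coarsening: $\alpha\lesssim\beta$ means that for every $\gamma<\alpha$ there are $\delta<\beta$ and $n\in\omega$ with $\gamma<\delta\cdot n$. Questions: for $y\in\mathbb R$, $p\in\mathbb Q$, $\varepsilon\in\mathbb Q^+$, a bit $b\in\{0,1\}$ is a correct answer to "$y\lesssim_\varepsilon p$" if either $b=1$ and $y<p+\varepsilon$, or $b=0$ and $y>p-\varepsilon$.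 $tt$-reducibility: $f\le_{\mathbf{tt}} g$ means: for every $p\in\mathbb Q,\varepsilon\in\mathbb Q^+$ there are $r\in\omega$, rationals $q_i$ and $\delta_i>0$ ($i<r$), continuous $k_i:2^\omega\to2^\omega$ ($i<r$) and a function $h:2^r\to\{0,1\}$ such that for every $A\in2^\omega$ and every $\sigma\in2^r$ such that each $\sigma(i)$ is a correct answer to $g(k_i(A))\lesssim_{\delta_i}q_i$, $h(\sigma)$ is a correct answer to $f(A)\lesssim_\varepsilon p$. *)

theory Defs
  imports "HOL-Analysis.Analysis"
begin

text \<open>Cantor space 2^omega, with the product topology (bool carries the discrete topology).\<close>
type_synonym cantor = "nat \<Rightarrow> bool"

definition baire0 :: "(cantor \<Rightarrow> real) \<Rightarrow> bool" where
  "baire0 f \<longleftrightarrow> continuous_on UNIV f"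

definition baire1 :: "(cantor \<Rightarrow> real) \<Rightarrow> bool" where
  "baire1 f \<longleftrightarrow> (\<exists>F :: nat \<Rightarrow> cantor \<Rightarrow> real.
      (\<forall>n. continuous_on UNIV (F n)) \<and> (\<forall>x. (\<lambda>n. F n x) \<longlonglongrightarrow> f x))"

text \<open>Ordinals below omega_1 are represented by elements of the field of the well-order
  omega1 = cardSuc natLeq (the first uncountable cardinal, as a well-order);
  the ordinal denoted by i is the order type of its strict initial segment.\<close>

definition omega1 :: "nat set rel" where
  "omega1 = cardSuc natLeq"

definition ord_of :: "nat set \<Rightarrow> nat set rel" where
  "ord_of i = Restr omega1 (underS omega1 i)"

definition ord_times_nat :: "'a rel \<Rightarrow> nat \<Rightarrow> ('a \<times> nat) rel" where
  "ord_times_nat r n = {((x,i),(y,j)). x \<in> Field r \<and> y \<in> Field r \<and> i < n \<and> j < n \<and>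
      (i < j \<or> (i = j \<and> (x,y) \<in> r))}"

definition ord_coarsening :: "nat set \<Rightarrow> nat set \<Rightarrow> bool" where
  "ord_coarsening a b \<longleftrightarrow>
     (\<forall>c \<in> underS omega1 a. \<exists>d \<in> underS omega1 b. \<exists>n::nat.
        (ord_of c, ord_times_nat (ord_of d) n) \<in> ordLess)"

definition optimal_derivative :: "'a::topological_space set set \<Rightarrow> 'a set \<Rightarrow> 'a set" where
  "optimal_derivative C P = P - \<Union>{U. open U \<and> (\<exists>c\<in>C. P \<inter> U \<subseteq> c)}"

definition opt_deriv_seq :: "'a::topological_space set set \<Rightarrow> nat set \<Rightarrow> 'a set" where
  "opt_deriv_seq C = wo_rel.worec omega1 (\<lambda>R i.
     if underS omega1 i = {} then UNIV
     else if (\<exists>j \<in> underS omega1 i. i = wo_rel.suc omega1 {j})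
       then optimal_derivative C (R (THE j. j \<in> underS omega1 i \<and> i = wo_rel.suc omega1 {j}))
     else (\<Inter>j \<in> underS omega1 i. R j))"

definition bourgain_family :: "(cantor \<Rightarrow> real) \<Rightarrow> real \<Rightarrow> real \<Rightarrow> cantor set set" where
  "bourgain_family f p \<epsilon> = {f -` {..<p + \<epsilon>}, f -` {p - \<epsilon><..}}"

definition bourgain_alpha :: "(cantor \<Rightarrow> real) \<Rightarrow> real \<Rightarrow> real \<Rightarrow> nat set" where
  "bourgain_alpha f p \<epsilon> =
     wo_rel.minim omega1 {i \<in> Field omega1. opt_deriv_seq (bourgain_family f p \<epsilon>) i = {}}"

definition bourgain_rank :: "(cantor \<Rightarrow> real) \<Rightarrow> nat set" where
  "bourgain_rank f = wo_rel.supr omega1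
     {bourgain_alpha f p \<epsilon> | p \<epsilon>. p \<in> \<rat> \<and> \<epsilon> \<in> \<rat> \<and> \<epsilon> > 0}"

text \<open>b is a correct answer to "y \<lesssim>_eps p" (True = bit 1, False = bit 0).\<close>
definition correct_answer :: "bool \<Rightarrow> real \<Rightarrow> real \<Rightarrow> real \<Rightarrow> bool" where
  "correct_answer b y p \<epsilon> \<longleftrightarrow> (b \<and> y < p + \<epsilon>) \<or> (\<not> b \<and> y > p - \<epsilon>)"

definition tt_reducible :: "(cantor \<Rightarrow> real) \<Rightarrow> (cantor \<Rightarrow> real) \<Rightarrow> bool" where
  "tt_reducible f g \<longleftrightarrow>
    (\<forall>p \<epsilon>. p \<in> \<rat> \<and> \<epsilon> \<in> \<rat> \<and> \<epsilon> > 0 \<longrightarrow>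
      (\<exists>(r::nat) (q::nat \<Rightarrow> real) (\<delta>::nat \<Rightarrow> real) (k::nat \<Rightarrow> cantor \<Rightarrow> cantor)
          (h::bool list \<Rightarrow> bool).
        (\<forall>i<r. q i \<in> \<rat> \<and> \<delta> i \<in> \<rat> \<and> \<delta> i > 0 \<and> continuous_on UNIV (k i)) \<and>
        (\<forall>A \<sigma>. length \<sigma> = r \<and> (\<forall>i<r. correct_answer (\<sigma> ! i) (g (k i A)) (q i) (\<delta> i))
            \<longrightarrow> correct_answer (h \<sigma>) (f A) p \<epsilon>)))"

end

theory Submission
  imports Defs
begin

text \<open>
  From right to left: let \<open>D\<close> be the derivative of \<open>f\<close> at \<open>(p, \<epsilon>)\<close>. The last nonempty iterate of
  \<open>D\<close> has an index below \<open>\<delta> \<cdot> n\<close> where the \<open>\<delta>\<close>-th derivative of \<open>g\<close> at some \<open>(q, \<eta>)\<close> contains a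
  point \<open>z\<close>. Put \<open>C 0 = 2\<^sup>\<omega>\<close> and let \<open>C (i + 1)\<close> be the \<open>\<delta>\<close>-th iterate of \<open>D\<close> on \<open>C i\<close>, so that
  \<open>C n\<close> is empty. For each \<open>i\<close> there is a continuous map that follows \<open>z\<close> and, whenever the rank of
  the current neighbourhood drops, moves on to a point of lower rank at which \<open>g\<close> takes a value far
  enough above or below \<open>q\<close>; it answers the question about \<open>f\<close> on \<open>C i - C (i + 1)\<close>. Membership in
  the closed sets \<open>C i\<close> is itself decided by questions about \<open>g\<close>, because \<open>g\<close> is discontinuous at
  \<open>z\<close>. So \<open>2n\<close> questions suffice.

  From left to right: a reduction bounds the derivative of \<open>f\<close> by the union of the derivatives of
  \<open>g \<circ> k i\<close>. The set of ordinals \<open>\<kappa>\<close> for which the same holds for the \<open>\<kappa>\<close>-th iterates contains 1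
  and is closed under suprema and under \<open>\<kappa> \<mapsto> \<kappa> \<cdot> \<omega>\<close>. If the derivatives of \<open>g\<close> vanish after stage
  \<open>\<beta>\<close>, then \<open>\<beta> < \<kappa> \<cdot> m\<close> for the largest such \<open>\<kappa> \<le> \<beta>\<close>, and the derivatives of \<open>f\<close> vanish at a
  finite multiple of \<open>\<beta>\<close>.
\<close>

unbundle cardinal_syntax

section \<open>Transfinite iteration along a well-order\<close>

text \<open>\<open>titer r D P x\<close> is the iterate of \<open>D\<close> on \<open>P\<close> whose index is the order type of the elements
  below \<open>x\<close>, and \<open>Titer r D P\<close> the one whose index is the order type of \<open>r\<close>. For monotone
  \<open>D\<close> with \<open>D A \<subseteq> A\<close> this single recursion covers the zero, successor and limit cases.\<close>

definition titer :: "'b rel \<Rightarrow> ('a set \<Rightarrow> 'a set) \<Rightarrow> 'a set \<Rightarrow> 'b \<Rightarrow> 'a set" where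
  "titer r D P = wo_rel.worec r (\<lambda>S x. P \<inter> (\<Inter>y\<in>underS r x. D (S y)))"

definition Titer :: "'b rel \<Rightarrow> ('a set \<Rightarrow> 'a set) \<Rightarrow> 'a set \<Rightarrow> 'a set" where
  "Titer r D P = P \<inter> (\<Inter>y\<in>Field r. D (titer r D P y))"

lemma titer_unfold:
  assumes "Well_order r"
  shows "titer r D P x = P \<inter> (\<Inter>y\<in>underS r x. D (titer r D P y))"
proof -
  interpret wo_rel r using assms by (simp add: wo_rel_def)
  have "adm_wo (\<lambda>S x. P \<inter> (\<Inter>y\<in>underS x. D (S y)))"
    unfolding adm_wo_def by auto
  from fun_cong[OF worec_fixpoint[OF this], of x] show ?thesis
    unfolding titer_def .
qed

lemma Well_order_induct_underS:
  assumes "Well_order r" and "\<And>x. (\<And>y. y \<in> underS r x \<Longrightarrow> Q y) \<Longrightarrow> Q x"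
  shows "Q a"
proof -
  interpret wo_rel r using assms(1) by (simp add: wo_rel_def)
  show ?thesis
    by (induction a rule: well_order_induct) (rule assms(2), auto simp: underS_def)
qed

text \<open>An embedding maps the segment below \<open>x\<close> onto the segment below
  \<open>h x\<close>, so an iterate depends only on the order type of its index. This allows indices
  from different well-orders to be compared.\<close>

lemma titer_embed:
  assumes r: "Well_order r" and r': "Well_order r'" and h: "embed r r' h" and "x \<in> Field r"
  shows "titer r' D P (h x) = titer r D P x"
  using assms(4)
proof (induction x rule: Well_order_induct_underS[OF r])
  case (1 x)
  have "underS r' (h x) = h ` underS r x"
    using embed_underS[OF r h 1(2)] by (simp add: bij_betw_def)
  moreover have "titer r' D P (h y) = titer r D P y" if "y \<in> underS r x" for y
    using 1(1)[OF that] that by (auto simp: underS_def Field_def)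
  ultimately show ?case
    by (simp add: titer_unfold[OF r, of _ _ x] titer_unfold[OF r', of _ _ "h x"])
qed

text \<open>An embedding turns the stages along \<open>r\<close> into some of the stages along
  \<open>r'\<close>, so the longer order intersects more sets.\<close>

lemma Titer_ordLeq:
  assumes "r \<le>o r'"
  shows "Titer r' D P \<subseteq> Titer r D P"
proof -
  obtain h where r: "Well_order r" and r': "Well_order r'" and h: "embed r r' h"
    using assms by (auto simp: ordLeq_def)
  show ?thesis
  proof
    fix x assume x: "x \<in> Titer r' D P"
    have "x \<in> D (titer r D P y)" if "y \<in> Field r" for y
    proof -
      have "h y \<in> Field r'" using embed_Field[OF h] that by auto
      then have "x \<in> D (titer r' D P (h y))" using x by (simp add: Titer_def)
      then show ?thesis by (simp add: titer_embed[OF r r' h that])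
    qed
    with x show "x \<in> Titer r D P" by (simp add: Titer_def)
  qed
qed

lemma Titer_ordIso: "r =o r' \<Longrightarrow> Titer r' D P = Titer r D P"
  unfolding ordIso_iff_ordLeq by (simp add: Titer_ordLeq subset_antisym)

lemma Titer_Restr_underS:
  assumes r: "Well_order r"
  shows "Titer (Restr r (underS r a)) D P = titer r D P a"
proof -
  let ?s = "Restr r (underS r a)"
  have of: "ofilter r (underS r a)"
    using r by (intro wo_rel.underS_ofilter) (simp add: wo_rel_def)
  have s: "Well_order ?s" by (rule Well_order_Restr[OF r])
  have F: "Field ?s = underS r a"
    using of by (simp add: Field_Restr_ofilter r)
  have emb: "embed ?s r id"
    using of ofilter_embed[OF r] by blast
  have "titer ?s D P x = titer r D P x" if "x \<in> underS r a" for x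
    using titer_embed[OF s r emb, of x D P] that F by simp
  then show ?thesis
    unfolding Titer_def F by (simp add: titer_unfold[OF r, of _ _ a])
qed

text \<open>The shorter order is isomorphic to the segment of \<open>r'\<close> below some
  \<open>a\<close>, and stage \<open>a\<close> enters the intersection with one further application
  of \<open>D\<close>.\<close>

lemma Titer_ordLess:
  assumes "r <o r'"
  shows "Titer r' D P \<subseteq> D (Titer r D P)"
proof -
  have w: "Well_order r" "Well_order r'" using assms by (auto simp: ordLess_def)
  then obtain a where a: "a \<in> Field r'" "r =o Restr r' (underS r' a)"
    using assms ordLess_iff_ordIso_Restr[OF w(2,1)] by blast
  have "Titer r D P = titer r' D P a"
    using Titer_ordIso[OF a(2), of D P] Titer_Restr_underS[OF w(2), of a D P] by simp
  with a show ?thesis by (auto simp: Titer_def)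
qed

lemma titer_subset: "Well_order r \<Longrightarrow> titer r D P x \<subseteq> P"
  using titer_unfold[of r D P x] by blast

lemma titer_mono:
  assumes r: "Well_order r" and D: "\<And>A B. A \<subseteq> B \<Longrightarrow> D A \<subseteq> E B" and "P \<subseteq> Q"
  shows "titer r D P x \<subseteq> titer r E Q x"
proof (induction x rule: Well_order_induct_underS[OF r])
  case (1 x)
  have "D (titer r D P y) \<subseteq> E (titer r E Q y)" if "y \<in> underS r x" for y
    using D[OF 1[OF that]] .
  then show ?case
    unfolding titer_unfold[OF r, of _ _ x] 
    by (rule Int_mono[OF assms(3) INF_superset_mono[OF subset_refl]])
qed

lemma titer_antimono:
  assumes r: "Well_order r" and "(x, y) \<in> r"
  shows "titer r D P y \<subseteq> titer r D P x"
proof -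
  have wo: "wo_rel r" using r by (simp add: wo_rel_def)
  have "underS r x \<subseteq> underS r y"
    using assms(2) wo_rel.TRANS[OF wo] wo_rel.ANTISYM[OF wo]
    by (auto simp: underS_def dest: transD antisymD)
  then show ?thesis
    unfolding titer_unfold[OF r, of D P x] titer_unfold[OF r, of D P y] by blast
qed

lemma titer_underS_subset:
  assumes r: "Well_order r" and "x \<in> underS r y"
  shows "titer r D P y \<subseteq> D (titer r D P x)"
  using assms(2) unfolding titer_unfold[OF r, of D P y] by blast

text \<open>Locality of \<open>D\<close> passes through all stages; with it a whole transfinite
  iterate can play the role of \<open>F\<close> in \<open>funpow_multiplicities\<close>.\<close>

lemma titer_Int_local:
  assumes r: "Well_order r" and D: "\<And>A B. A \<subseteq> B \<Longrightarrow> D A \<subseteq> D B"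
    and loc: "\<And>A. D A \<inter> U \<subseteq> D (A \<inter> U)"
  shows "titer r D P x \<inter> U \<subseteq> titer r D (P \<inter> U) x"
proof (induction x rule: Well_order_induct_underS[OF r])
  case (1 x)
  have "D (titer r D P y) \<inter> U \<subseteq> D (titer r D (P \<inter> U) y)" if "y \<in> underS r x" for y
    using D[OF 1[OF that]] loc by blast
  then show ?case
    unfolding titer_unfold[OF r, of _ _ x] by (simp add: subset_iff)
qed

section \<open>Finite multiples of an ordinal as iteration indices\<close>

lemma Field_ord_times_nat:
  assumes "Well_order r"
  shows "Field (ord_times_nat r n) = Field r \<times> {..<n}"
proof
  show "Field (ord_times_nat r n) \<subseteq> Field r \<times> {..<n}"
    unfolding subset_iff Field_iff[of _ "ord_times_nat r n"]
    by (auto simp: ord_times_nat_def)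
next
  have "(x, x) \<in> r" if "x \<in> Field r" for x
    using wo_rel.REFL[of r] that assms by (auto simp: wo_rel_def refl_on_def)
  then have "(z, z) \<in> ord_times_nat r n" if "z \<in> Field r \<times> {..<n}" for z
    using that by (auto simp: ord_times_nat_def)
  then show "Field r \<times> {..<n} \<subseteq> Field (ord_times_nat r n)"
    by (meson FieldI1 subsetI)
qed

lemma Well_order_ord_times_nat:
  assumes "Well_order r"
  shows "Well_order (ord_times_nat r n)"
proof -
  interpret wo_rel r using assms by (simp add: wo_rel_def)
  let ?s = "ord_times_nat r n"
  have F: "Field ?s = Field r \<times> {..<n}" by (rule Field_ord_times_nat[OF assms])
  have "Refl ?s"
    using REFL unfolding refl_on_def F by (auto simp: ord_times_nat_def)
  moreover have "trans ?s"
    using TRANS unfolding trans_def ord_times_nat_def by force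
  moreover have "antisym ?s"
    using ANTISYM unfolding antisym_def ord_times_nat_def by force
  moreover have "Total ?s"
    using TOTALS unfolding total_on_def F by (auto simp: ord_times_nat_def)
  moreover have "wf (?s - Id)"
  proof (rule wf_subset)
    show "wf (inv_image (less_than <*lex*> (r - Id)) prod.swap)"
      using WF by (intro wf_inv_image wf_lex_prod wf_less_than)
    show "?s - Id \<subseteq> inv_image (less_than <*lex*> (r - Id)) prod.swap"
      by (auto simp: ord_times_nat_def in_inv_image)
  qed
  ultimately show ?thesis
    unfolding well_order_on_def linear_order_on_def partial_order_on_def preorder_on_def
    by (auto simp: Field_def)
qed

text \<open>Unrolls \<open>n\<close> blocks of length \<open>r\<close> into one intersection, the
  shape that the recursion along \<open>ord_times_nat r n\<close> produces.\<close>

lemma funpow_Titer_eq: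
  "((Titer r D) ^^ n) P = P \<inter> (\<Inter>j<n. \<Inter>y\<in>Field r. D (titer r D ((Titer r D ^^ j) P) y))"
proof (induction n)
  case (Suc n)
  have "((Titer r D) ^^ Suc n) P = Titer r D ((Titer r D ^^ n) P)" by simp
  also have "\<dots> = (Titer r D ^^ n) P \<inter> (\<Inter>y\<in>Field r. D (titer r D ((Titer r D ^^ n) P) y))"
    by (simp only: Titer_def[of r D "(Titer r D ^^ n) P"])
  also have "\<dots> = P \<inter> (\<Inter>j<n. \<Inter>y\<in>Field r. D (titer r D ((Titer r D ^^ j) P) y))
      \<inter> (\<Inter>y\<in>Field r. D (titer r D ((Titer r D ^^ n) P) y))"
    by (simp only: Suc)
  also have "\<dots> = P \<inter> (\<Inter>j<Suc n. \<Inter>y\<in>Field r. D (titer r D ((Titer r D ^^ j) P) y))"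
    by (simp only: lessThan_Suc) blast
  finally show ?case .
qed simp

lemma INT_Times: "(\<Inter>w\<in>A \<times> B. F (fst w) (snd w)) = (\<Inter>j\<in>B. \<Inter>y\<in>A. F y j)"
  by force

text \<open>Below \<open>(x, i)\<close> lie the copies \<open>0, ..., i - 1\<close> in full and the
  part of copy \<open>i\<close> below \<open>x\<close>. The full copies contribute the
  \<open>i\<close>-fold \<open>Titer\<close>, from which the last copy starts.\<close>

lemma titer_ord_times_nat:
  assumes r: "Well_order r" and "fst z \<in> Field r" "snd z < n"
  shows "titer (ord_times_nat r n) D P z = titer r D ((Titer r D ^^ snd z) P) (fst z)"
  using assms(2,3)
proof (induction z rule: Well_order_induct_underS[OF Well_order_ord_times_nat[OF r, of n]])
  case (1 z)
  obtain x i where z: "z = (x, i)" by (cases z)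
  have xi: "x \<in> Field r" "i < n" using 1 z by auto
  let ?s = "ord_times_nat r n"
  have U: "underS ?s z = Field r \<times> {..<i} \<union> underS r x \<times> {i}"
    using xi by (auto simp: underS_def ord_times_nat_def z Field_def)
  have IH: "titer ?s D P (y, j) = titer r D ((Titer r D ^^ j) P) y" if "(y, j) \<in> underS ?s z" for y j
    using 1(1)[OF that] that by (auto simp: underS_def ord_times_nat_def)
  have "titer ?s D P z = P \<inter> (\<Inter>w\<in>underS ?s z. D (titer ?s D P w))"
    by (rule titer_unfold[OF Well_order_ord_times_nat[OF r]])
  also have "\<dots> = P \<inter> (\<Inter>w\<in>underS ?s z. D (titer r D ((Titer r D ^^ snd w) P) (fst w)))"
    by (rule arg_cong[where f = "(\<inter>) P"], rule INF_cong) (auto simp: IH)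
  also have "\<dots> = (P \<inter> (\<Inter>j<i. \<Inter>y\<in>Field r. D (titer r D ((Titer r D ^^ j) P) y)))
      \<inter> (\<Inter>y\<in>underS r x. D (titer r D ((Titer r D ^^ i) P) y))"
    unfolding U INT_Un INT_Times[where F = "\<lambda>y j. D (titer r D ((Titer r D ^^ j) P) y)"]
    by (simp add: Int_assoc)
  also have "\<dots> = (Titer r D ^^ i) P \<inter> (\<Inter>y\<in>underS r x. D (titer r D ((Titer r D ^^ i) P) y))"
    by (simp only: funpow_Titer_eq[symmetric])
  also have "\<dots> = titer r D ((Titer r D ^^ i) P) x"
    by (rule titer_unfold[OF r, symmetric])
  finally show ?case by (simp add: z)
qed

lemma Titer_ord_times_nat:
  assumes r: "Well_order r"
  shows "Titer (ord_times_nat r n) D P = (Titer r D ^^ n) P"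
proof -
  have "Titer (ord_times_nat r n) D P
      = P \<inter> (\<Inter>w\<in>Field r \<times> {..<n}. D (titer (ord_times_nat r n) D P w))"
    unfolding Titer_def Field_ord_times_nat[OF r] ..
  also have "\<dots> = P \<inter> (\<Inter>w\<in>Field r \<times> {..<n}. D (titer r D ((Titer r D ^^ snd w) P) (fst w)))"
    by (rule arg_cong[where f = "(\<inter>) P"], rule INF_cong) (auto simp: titer_ord_times_nat[OF r])
  also have "\<dots> = P \<inter> (\<Inter>j<n. \<Inter>y\<in>Field r. D (titer r D ((Titer r D ^^ j) P) y))"
    unfolding INT_Times[where F = "\<lambda>y j. D (titer r D ((Titer r D ^^ j) P) y)"] ..
  finally show ?thesis by (simp only: funpow_Titer_eq[symmetric])
qed

section \<open>The first uncountable ordinal\<close>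

lemma countable_iff_card_le_natLeq: "countable A \<longleftrightarrow> |A| \<le>o natLeq"
proof -
  have "countable A \<longleftrightarrow> |A| \<le>o |UNIV :: nat set|"
    unfolding countable_def card_of_ordLeq[symmetric] by auto
  then show ?thesis
    using card_of_nat ordLeq_ordIso_trans ordIso_symmetric by blast
qed

lemma Card_order_omega1: "Card_order omega1"
  unfolding omega1_def by (intro cardSuc_Card_order natLeq_Card_order)

lemma Well_order_omega1: "Well_order omega1"
  using Card_order_omega1 by (rule card_order_on_well_order_on)

lemma wo_rel_omega1: "wo_rel omega1"
  using Well_order_omega1 by (simp add: wo_rel_def)

lemma uncountable_Field_omega1: "uncountable (Field omega1)"
proof
  assume "countable (Field omega1)"
  then have "|Field omega1| \<le>o natLeq" by (simp add: countable_iff_card_le_natLeq)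
  moreover have "|Field omega1| =o omega1"
    by (rule card_of_Field_ordIso[OF Card_order_omega1])
  moreover have "natLeq <o omega1"
    unfolding omega1_def by (rule cardSuc_greater[OF natLeq_Card_order])
  ultimately show False
    using not_ordLess_ordLeq ordIso_ordLeq_trans ordIso_symmetric by blast
qed

lemma countable_underS_omega1: "a \<in> Field omega1 \<Longrightarrow> countable (underS omega1 a)"
  using card_of_underS[OF Card_order_omega1] cardSuc_ordLeq_ordLess[OF natLeq_Card_order card_of_Card_order]
  unfolding countable_iff_card_le_natLeq omega1_def by blast

lemma not_le_omega1:
  assumes "a \<in> Field omega1" "b \<in> Field omega1" "(a, b) \<notin> omega1"
  shows "b \<in> underS omega1 a"
  using assms wo_rel.TOTALS[OF wo_rel_omega1] wo_rel.REFL[OF wo_rel_omega1]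
  by (auto simp: underS_def refl_on_def)

lemma underS_imp_not_le_omega1: "b \<in> underS omega1 a \<Longrightarrow> (a, b) \<notin> omega1"
  using wo_rel.ANTISYM[OF wo_rel_omega1] by (auto simp: underS_def dest: antisymD)

lemma underS_trans_le_omega1:
  "(b, c) \<in> omega1 \<Longrightarrow> a \<in> underS omega1 b \<Longrightarrow> a \<in> underS omega1 c"
  using wo_rel.TRANS[OF wo_rel_omega1] wo_rel.ANTISYM[OF wo_rel_omega1]
  by (auto simp: underS_def dest: transD antisymD)

lemma le_trans_underS_omega1:
  "(a, b) \<in> omega1 \<Longrightarrow> b \<in> underS omega1 c \<Longrightarrow> a \<in> underS omega1 c"
  using wo_rel.TRANS[OF wo_rel_omega1] wo_rel.ANTISYM[OF wo_rel_omega1]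
  by (auto simp: underS_def dest: transD antisymD)

lemma underS_Field_omega1: "a \<in> underS omega1 b \<Longrightarrow> a \<in> Field omega1 \<and> b \<in> Field omega1"
  by (auto simp: underS_def Field_def)

text \<open>Regularity of the first uncountable ordinal: the field would otherwise be a countable
  union of countable segments.\<close>

lemma Above_omega1_nonempty:
  assumes "countable A" "A \<subseteq> Field omega1"
  shows "Above omega1 A \<noteq> {}"
proof
  assume *: "Above omega1 A = {}"
  have "Field omega1 \<subseteq> (\<Union>a\<in>A. underS omega1 a)"
  proof
    fix b assume b: "b \<in> Field omega1"
    then obtain a where "a \<in> A" "(a, b) \<notin> omega1"
      using * by (auto simp: Above_def)
    with b assms show "b \<in> (\<Union>a\<in>A. underS omega1 a)"
      using not_le_omega1[of a b] by auto
  qed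
  moreover have "countable (\<Union>a\<in>A. underS omega1 a)"
    using assms countable_underS_omega1 by blast
  ultimately show False
    using uncountable_Field_omega1 countable_subset by blast
qed

lemma supr_omega1:
  assumes "countable A" "A \<subseteq> Field omega1"
  shows supr_omega1_Field: "wo_rel.supr omega1 A \<in> Field omega1"
    and supr_omega1_upper: "\<And>a. a \<in> A \<Longrightarrow> (a, wo_rel.supr omega1 A) \<in> omega1"
    and supr_omega1_least:
      "\<And>b. b \<in> Field omega1 \<Longrightarrow> (\<And>a. a \<in> A \<Longrightarrow> (a, b) \<in> omega1) \<Longrightarrow> (wo_rel.supr omega1 A, b) \<in> omega1"
    and underS_supr_omega1: "\<And>c. c \<in> underS omega1 (wo_rel.supr omega1 A) \<Longrightarrow> \<exists>a\<in>A. c \<in> underS omega1 a"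
proof -
  have sub: "Above omega1 A \<subseteq> Field omega1" by (auto simp: Above_def)
  have "wo_rel.supr omega1 A \<in> Above omega1 A"
    unfolding wo_rel.supr_def[OF wo_rel_omega1]
    by (rule wo_rel.minim_in[OF wo_rel_omega1 sub Above_omega1_nonempty[OF assms]])
  then show 1: "wo_rel.supr omega1 A \<in> Field omega1"
    and "\<And>a. a \<in> A \<Longrightarrow> (a, wo_rel.supr omega1 A) \<in> omega1"
    by (auto simp: Above_def)
  show least: "(wo_rel.supr omega1 A, b) \<in> omega1"
    if "b \<in> Field omega1" "\<And>a. a \<in> A \<Longrightarrow> (a, b) \<in> omega1" for b
    unfolding wo_rel.supr_def[OF wo_rel_omega1]
    by (rule wo_rel.minim_least[OF wo_rel_omega1 sub]) (use that in \<open>auto simp: Above_def\<close>)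
  show "\<exists>a\<in>A. c \<in> underS omega1 a" if c: "c \<in> underS omega1 (wo_rel.supr omega1 A)" for c
  proof (rule ccontr)
    assume "\<not> ?thesis"
    then have "(a, c) \<in> omega1" if "a \<in> A" for a
      using that not_le_omega1[of a c] underS_Field_omega1[OF c] assms(2) by blast
    then have "(wo_rel.supr omega1 A, c) \<in> omega1"
      using least underS_Field_omega1[OF c] by blast
    then show False using underS_imp_not_le_omega1[OF c] by blast
  qed
qed

lemma AboveS_singleton_omega1: "a \<in> Field omega1 \<Longrightarrow> AboveS omega1 {a} \<noteq> {}"
  using infinite_Card_order_limit[OF Card_order_omega1, of a] uncountable_Field_omega1
  by (auto simp: AboveS_def dest: countable_finite)

lemma underS_suc_omega1:
  assumes "a \<in> Field omega1"
  shows "underS omega1 (wo_rel.suc omega1 {a}) = insert a (underS omega1 a)"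
proof -
  let ?s = "wo_rel.suc omega1 {a}"
  have gt: "a \<in> underS omega1 ?s"
    using wo_rel.suc_greater[OF wo_rel_omega1 _ AboveS_singleton_omega1[OF assms], of a] assms
    by (auto simp: underS_def)
  have "c \<in> insert a (underS omega1 a)" if c: "c \<in> underS omega1 ?s" for c
  proof (rule ccontr)
    assume "\<not> ?thesis"
    then have "c \<in> AboveS omega1 {a}"
      using not_le_omega1[of a c] underS_Field_omega1[OF c] assms by (auto simp: AboveS_def)
    then have "(?s, c) \<in> omega1"
      by (rule wo_rel.suc_least_AboveS[OF wo_rel_omega1])
    then show False using underS_imp_not_le_omega1[OF c] by blast
  qed
  moreover have "c \<in> underS omega1 ?s" if "c \<in> underS omega1 a" for c
    using underS_trans_le_omega1[of a ?s c] gt that by (auto simp: underS_def)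
  ultimately show ?thesis using gt by blast
qed

lemma suc_Field_omega1: "a \<in> Field omega1 \<Longrightarrow> wo_rel.suc omega1 {a} \<in> Field omega1"
  by (rule wo_rel.suc_inField[OF wo_rel_omega1 _ AboveS_singleton_omega1]) auto

lemma suc_inj_omega1:
  assumes "a \<in> Field omega1" "b \<in> Field omega1" "wo_rel.suc omega1 {a} = wo_rel.suc omega1 {b}"
  shows "a = b"
proof (rule ccontr)
  assume ne: "a \<noteq> b"
  have "insert a (underS omega1 a) = insert b (underS omega1 b)"
    using underS_suc_omega1[OF assms(1)] underS_suc_omega1[OF assms(2)] assms(3) by simp
  then have "a \<in> underS omega1 b" "b \<in> underS omega1 a" using ne by auto
  then show False using underS_imp_not_le_omega1[of b a] by (simp add: underS_def)
qed

lemma suc_le_omega1: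
  assumes "a \<in> underS omega1 b"
  shows "(wo_rel.suc omega1 {a}, b) \<in> omega1"
  by (rule wo_rel.suc_least_AboveS[OF wo_rel_omega1])
    (use assms in \<open>auto simp: AboveS_def underS_def Field_def\<close>)

lemma titer_suc_omega1:
  assumes "a \<in> Field omega1" and D: "\<And>A B. A \<subseteq> B \<Longrightarrow> D A \<subseteq> D B" and le: "\<And>A. D A \<subseteq> A"
  shows "titer omega1 D P (wo_rel.suc omega1 {a}) = D (titer omega1 D P a)"
proof
  show "titer omega1 D P (wo_rel.suc omega1 {a}) \<subseteq> D (titer omega1 D P a)"
    by (rule titer_underS_subset[OF Well_order_omega1]) (simp add: underS_suc_omega1[OF assms(1)])
  have "D (titer omega1 D P a) \<subseteq> P"
    by (rule subset_trans[OF le titer_subset[OF Well_order_omega1]])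
  moreover have "D (titer omega1 D P a) \<subseteq> D (titer omega1 D P b)" if "b \<in> underS omega1 a" for b
    using that by (intro D[OF titer_antimono[OF Well_order_omega1]]) (simp add: underS_def)
  ultimately show "D (titer omega1 D P a) \<subseteq> titer omega1 D P (wo_rel.suc omega1 {a})"
    by (subst titer_unfold[OF Well_order_omega1], subst underS_suc_omega1[OF assms(1)])
      (auto simp only: Int_subset_iff INT_subset_iff insert_iff le_INF_iff)
qed

section \<open>The optimal derivative and its iterates\<close>

lemma optimal_derivative_subset: "optimal_derivative C P \<subseteq> P"
  by (auto simp: optimal_derivative_def)

lemma optimal_derivative_iff:
  "x \<in> optimal_derivative C P \<longleftrightarrow> x \<in> P \<and> (\<forall>U. \<forall>c\<in>C. open U \<longrightarrow> x \<in> U \<longrightarrow> \<not> P \<inter> U \<subseteq> c)"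
  unfolding optimal_derivative_def Diff_iff Union_iff mem_Collect_eq Bex_def Ball_def by blast

lemma optimal_derivative_mono:
  assumes "P \<subseteq> Q"
  shows "optimal_derivative C P \<subseteq> optimal_derivative C Q"
proof
  fix x assume x: "x \<in> optimal_derivative C P"
  have "\<not> Q \<inter> U \<subseteq> c" if "open U" "c \<in> C" "x \<in> U" for U c
  proof -
    have "\<not> P \<inter> U \<subseteq> c" using x that unfolding optimal_derivative_iff by simp
    then show ?thesis using assms by auto
  qed
  with x assms show "x \<in> optimal_derivative C Q"
    unfolding optimal_derivative_iff by auto
qed

lemma optimal_derivative_Int_open:
  assumes "open U"
  shows "optimal_derivative C P \<inter> U \<subseteq> optimal_derivative C (P \<inter> U)"
proof
  fix x assume x: "x \<in> optimal_derivative C P \<inter> U"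
  have "\<not> P \<inter> U \<inter> V \<subseteq> c" if "open V" "c \<in> C" "x \<in> V" for V c
  proof -
    have "open (U \<inter> V)" using assms that(1) by (rule open_Int)
    then show ?thesis
      using that x by (simp add: optimal_derivative_iff Int_assoc)
  qed
  with x show "x \<in> optimal_derivative C (P \<inter> U)"
    by (simp add: optimal_derivative_iff)
qed

lemma closed_optimal_derivative:
  assumes "closed P"
  shows "closed (optimal_derivative C P)"
  unfolding optimal_derivative_def by (intro closed_Diff assms open_Union) auto

lemma closed_titer:
  assumes r: "Well_order r" and D: "\<And>A. closed A \<Longrightarrow> closed (D A)" and "closed P"
  shows "closed (titer r D P x)"
proof (induction x rule: Well_order_induct_underS[OF r])
  case (1 x)
  then show ?case
    unfolding titer_unfold[OF r, of D P x] by (intro closed_Int closed_INT assms ballI) auto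
qed

text \<open>Links the recursion by cases behind the rank to the uniform recursion of
  \<open>titer\<close>, which replaces it from here on.\<close>

lemma opt_deriv_seq_eq_titer:
  assumes "i \<in> Field omega1"
  shows "opt_deriv_seq C i = titer omega1 (optimal_derivative C) UNIV i"
  using assms
proof (induction i rule: Well_order_induct_underS[OF Well_order_omega1])
  case (1 i)
  let ?D = "optimal_derivative C" and ?w = omega1
  let ?T = "titer ?w ?D UNIV"
  let ?H = "\<lambda>R i. if underS ?w i = {} then UNIV
     else if (\<exists>j \<in> underS ?w i. i = wo_rel.suc ?w {j})
       then ?D (R (THE j. j \<in> underS ?w i \<and> i = wo_rel.suc ?w {j}))
     else (\<Inter>j \<in> underS ?w i. R j)"
  \<comment> \<open>Successors are injective, so the definite description picks the
    predecessor.\<close>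
  have the: "(THE j. j \<in> underS ?w i \<and> i = wo_rel.suc ?w {j}) = j"
    if "j \<in> underS ?w i" "i = wo_rel.suc ?w {j}" for i j
  proof (rule the_equality)
    fix k assume k: "k \<in> underS ?w i \<and> i = wo_rel.suc ?w {k}"
    show "k = j"
      by (rule suc_inj_omega1) (use k that underS_Field_omega1 in \<open>auto\<close>)
  qed (use that in auto)
  have "wo_rel.adm_wo ?w ?H"
    unfolding wo_rel.adm_wo_def[OF wo_rel_omega1]
  proof (intro allI impI)
    fix R R' :: "nat set \<Rightarrow> 'a set" and i
    assume *: "\<forall>y\<in>underS ?w i. R y = R' y"
    show "?H R i = ?H R' i"
    proof (cases "\<exists>j \<in> underS ?w i. i = wo_rel.suc ?w {j}")
      case True
      then obtain j where j: "j \<in> underS ?w i" "i = wo_rel.suc ?w {j}" by blast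
      then show ?thesis using the[OF j] * by auto
    qed (use * in auto)
  qed
  from fun_cong[OF wo_rel.worec_fixpoint[OF wo_rel_omega1 this], of i]
  have unf: "opt_deriv_seq C i = ?H (opt_deriv_seq C) i"
    unfolding opt_deriv_seq_def .
  have IH: "opt_deriv_seq C j = ?T j" if "j \<in> underS ?w i" for j
    using 1(1)[OF that] underS_Field_omega1[OF that] by blast
  show ?case
  proof (cases "\<exists>j \<in> underS ?w i. i = wo_rel.suc ?w {j}")
    case True
    then obtain j where j: "j \<in> underS ?w i" "i = wo_rel.suc ?w {j}" by blast
    have "opt_deriv_seq C i = ?D (opt_deriv_seq C j)"
      using unf the[OF j] j by auto
    also have "\<dots> = ?D (?T j)" by (simp only: IH[OF j(1)])
    also have "\<dots> = ?T (wo_rel.suc ?w {j})"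
      using underS_Field_omega1[OF j(1)]
      by (intro titer_suc_omega1[symmetric] optimal_derivative_mono optimal_derivative_subset) auto
    finally show ?thesis using j(2) by simp
  next
    case False
    \<comment> \<open>Index 0 falls under this case too: the empty intersection is
      \<open>UNIV\<close>.\<close>
    then have "opt_deriv_seq C i = (\<Inter>j \<in> underS ?w i. opt_deriv_seq C j)"
      using unf by auto
    also have "\<dots> = (\<Inter>j \<in> underS ?w i. ?T j)"
      by (rule INF_cong) (auto simp: IH)
    also have "\<dots> = ?T i"
    proof
      show "?T i \<subseteq> (\<Inter>j \<in> underS ?w i. ?T j)"
        by (intro INT_greatest titer_antimono[OF Well_order_omega1]) (simp add: underS_def)
      \<comment> \<open>With \<open>j\<close> also its successor lies below \<open>i\<close>, so
        intersecting the stages below \<open>i\<close> already includes their derivatives.\<close>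
      have "(\<Inter>j \<in> underS ?w i. ?T j) \<subseteq> ?D (?T j)" if j: "j \<in> underS ?w i" for j
      proof -
        have "wo_rel.suc ?w {j} \<in> underS ?w i"
          using suc_le_omega1[OF j] False j by (auto simp: underS_def)
        then show ?thesis
          using underS_Field_omega1[OF j]
            titer_suc_omega1[of j ?D UNIV, OF _ optimal_derivative_mono optimal_derivative_subset]
          by blast
      qed
      then show "(\<Inter>j \<in> underS ?w i. ?T j) \<subseteq> ?T i"
        unfolding titer_unfold[OF Well_order_omega1, of ?D UNIV i] by blast
    qed
    finally show ?thesis .
  qed
qed

section \<open>Cantor space and the Bourgain rank\<close>

text \<open>The basic clopen sets. Two of the same length are equal or disjoint, which is what makes
  the gluing of local maps work.\<close>

definition cyl :: "cantor \<Rightarrow> nat \<Rightarrow> cantor set" where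
  "cyl x n = {y. \<forall>i<n. y i = x i}"

lemma self_mem_cyl [simp]: "x \<in> cyl x n"
  by (simp add: cyl_def)

lemma cyl_eq: "y \<in> cyl x n \<Longrightarrow> cyl y n = cyl x n"
  by (simp add: cyl_def)

lemma cyl_antimono: "m \<le> n \<Longrightarrow> cyl x n \<subseteq> cyl x m"
  by (auto simp: cyl_def)

lemma clopen_cyl: "open (cyl x n)" "closed (cyl x n)"
proof -
  have eq: "cyl x n = (\<Inter>i\<in>{..<n}. (\<lambda>y. y i) -` {x i})" by (auto simp: cyl_def)
  have c: "continuous_on UNIV (\<lambda>y::cantor. y i)" for i
    by (rule continuous_on_product_coordinates)
  show "open (cyl x n)" unfolding eq
    by (intro open_INT ballI open_vimage[OF _ c] open_discrete) auto
  show "closed (cyl x n)" unfolding eq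
    by (intro closed_INT ballI closed_vimage[OF _ c]) auto
qed

lemma countable_cylinders: "countable (\<Union>n. range (\<lambda>x. cyl x n))"
proof (intro countable_UN countableI_type)
  fix n
  have "range (\<lambda>x. cyl x n) \<subseteq> range (\<lambda>l. {y. map y [0..<n] = l})"
  proof
    fix A assume "A \<in> range (\<lambda>x. cyl x n)"
    then obtain x where "A = cyl x n" by auto
    then have "A = {y. map y [0..<n] = map x [0..<n]}" by (auto simp: cyl_def)
    then show "A \<in> range (\<lambda>l. {y. map y [0..<n] = l})" by (rule image_eqI) simp
  qed
  then show "countable (range (\<lambda>x. cyl x n))"
    by (rule countable_subset) simp
qed

lemma Hausdorff_cantor: "Hausdorff_space (euclidean :: cantor topology)"
  unfolding Hausdorff_space_def
proof (intro allI impI)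
  fix x y :: cantor assume "x \<in> topspace euclidean \<and> y \<in> topspace euclidean \<and> x \<noteq> y"
  then obtain i where i: "x i \<noteq> y i" by auto
  have "disjnt (cyl x (Suc i)) (cyl y (Suc i))"
    using i by (auto simp: disjnt_def cyl_def)
  then show "\<exists>U V. openin euclidean U \<and> openin euclidean V \<and> x \<in> U \<and> y \<in> V \<and> disjnt U V"
    by (intro exI[of _ "cyl x (Suc i)"] exI[of _ "cyl y (Suc i)"]) (simp add: clopen_cyl)
qed

lemma open_contains_cyl:
  assumes "open (U :: cantor set)" "x \<in> U"
  obtains n where "cyl x n \<subseteq> U"
proof -
  have "openin (product_topology (\<lambda>i. euclidean) UNIV) U"
    using assms(1) by (simp add: open_fun_def)
  from product_topology_open_contains_basis[OF this assms(2), unfolded topspace_euclidean]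
  obtain X where X: "x \<in> (\<Pi>\<^sub>E i\<in>UNIV. X i)" "finite {i. X i \<noteq> UNIV}" "(\<Pi>\<^sub>E i\<in>UNIV. X i) \<subseteq> U"
    by (elim exE conjE) (rule that)
  obtain n where n: "\<forall>i \<in> {i. X i \<noteq> UNIV}. i < n"
    using finite_nat_set_iff_bounded[THEN iffD1, OF X(2)] by (elim exE) (rule that)
  have "cyl x n \<subseteq> (\<Pi>\<^sub>E i\<in>UNIV. X i)"
  proof
    fix y assume y: "y \<in> cyl x n"
    have "y i \<in> X i" for i
    proof (cases "X i = UNIV")
      case False
      then have "y i = x i" using n y by (simp add: cyl_def)
      then show ?thesis using X(1) by (simp add: PiE_iff)
    qed simp
    then show "y \<in> (\<Pi>\<^sub>E i\<in>UNIV. X i)" by (simp add: PiE_iff)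
  qed
  then show ?thesis using X(3) by (intro that) (rule subset_trans)
qed

lemma compact_cantor: "compact (UNIV :: cantor set)"
proof -
  have "compact_space (euclidean :: bool topology)"
    by (simp add: compact_space_def finite_imp_compact)
  then have "compact_space (product_topology (\<lambda>i. euclidean :: bool topology) (UNIV :: nat set))"
    by (simp add: compact_space_product_topology)
  then have "compact_space (euclidean :: cantor topology)"
    unfolding euclidean_product_topology .
  then show ?thesis
    unfolding compact_space_def topspace_euclidean compactin_euclidean_iff .
qed

abbreviation bder :: "(cantor \<Rightarrow> real) \<Rightarrow> real \<Rightarrow> real \<Rightarrow> cantor set \<Rightarrow> cantor set" where
  "bder f p \<epsilon> \<equiv> optimal_derivative (bourgain_family f p \<epsilon>)"

lemma bder_iff:
  "x \<in> bder f p e P \<longleftrightarrow> x \<in> P \<and>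
     (\<forall>U. open U \<longrightarrow> x \<in> U \<longrightarrow> (\<exists>y\<in>P \<inter> U. p + e \<le> f y) \<and> (\<exists>y\<in>P \<inter> U. f y \<le> p - e))"
proof -
  have 1: "\<not> P \<inter> U \<subseteq> f -` {..<p + e} \<longleftrightarrow> (\<exists>y\<in>P \<inter> U. p + e \<le> f y)" for U
    by (auto simp: not_less)
  have 2: "\<not> P \<inter> U \<subseteq> f -` {p - e<..} \<longleftrightarrow> (\<exists>y\<in>P \<inter> U. f y \<le> p - e)" for U
    by (auto simp: not_less)
  have "x \<in> optimal_derivative {A, B} P \<longleftrightarrow>
      x \<in> P \<and> (\<forall>U. open U \<longrightarrow> x \<in> U \<longrightarrow> \<not> P \<inter> U \<subseteq> A \<and> \<not> P \<inter> U \<subseteq> B)" for A B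
    unfolding optimal_derivative_iff by simp
  then show ?thesis
    unfolding bourgain_family_def 1[symmetric] 2[symmetric] .
qed

section \<open>Termination of the derivation for functions of the first Baire class\<close>

lemma closed_titer_bder: "closed P \<Longrightarrow> closed (titer omega1 (bder f p e) P a)"
  by (rule closed_titer[OF Well_order_omega1 closed_optimal_derivative])

text \<open>By the Baire category theorem on \<open>P\<close>, some relatively open piece of
  \<open>P\<close> lies in one set \<open>T n\<close>, where \<open>f\<close> is within
  \<open>e / 2\<close> of the continuous \<open>F n\<close>. Near a point of that piece the values
  of \<open>f\<close> differ by less than \<open>2 * e\<close>, so they cannot reach both
  \<open>p + e\<close> and \<open>p - e\<close>.\<close>

lemma bder_proper:
  assumes "baire1 f" "closed P" "P \<noteq> {}" "e > 0"
  shows "bder f p e P \<noteq> P"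
proof -
  obtain F where F: "\<And>n. continuous_on UNIV (F n)" and lim: "\<And>x. (\<lambda>n. F n x) \<longlonglongrightarrow> f x"
    using assms(1) by (auto simp: baire1_def)
  \<comment> \<open>The points at which the approximating sequence has settled up to
    \<open>e / 2\<close> from index \<open>n\<close> on.\<close>
  define T where "T n = {x \<in> P. \<forall>m\<ge>n. \<forall>k\<ge>n. \<bar>F m x - F k x\<bar> \<le> e / 2}" for n
  have "compact P" using compact_Int_closed[OF compact_cantor assms(2)] by simp
  then have cs: "compact_space (top_of_set P)" by (simp add: compact_space_def compactin_subtopology)
  have "Hausdorff_space (top_of_set P)"
    by (intro Hausdorff_space_subtopology Hausdorff_cantor)
  then have reg: "regular_space (top_of_set P)"
    using cs by (simp add: compact_Hausdorff_imp_regular_space)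
  have cl: "closedin (top_of_set P) (T n)" for n
  proof -
    have "T n = P \<inter> (\<Inter>m\<in>{n..}. \<Inter>k\<in>{n..}. {x. \<bar>F m x - F k x\<bar> \<le> e / 2})"
      by (auto simp: T_def)
    moreover have "closed {x. \<bar>F m x - F k x\<bar> \<le> e / 2}" for m k
      by (intro closed_Collect_le continuous_intros F)
    ultimately show ?thesis
      unfolding closedin_closed by (metis (no_types, lifting) closed_INT)
  qed
  have un: "(\<Union>n. T n) = P"
  proof
    show "P \<subseteq> (\<Union>n. T n)"
    proof
      fix x assume "x \<in> P"
      have "Cauchy (\<lambda>n. F n x)" using lim LIMSEQ_imp_Cauchy by blast
      then obtain n where "\<And>m k. m \<ge> n \<Longrightarrow> k \<ge> n \<Longrightarrow> norm (F m x - F k x) < e / 2"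
        using assms(4) CauchyD[of "\<lambda>n. F n x" "e / 2"] by auto
      then have "x \<in> T n" using \<open>x \<in> P\<close> unfolding T_def by (auto intro: less_imp_le)
      then show "x \<in> (\<Union>n. T n)" by blast
    qed
  qed (auto simp: T_def)
  have "\<exists>n. top_of_set P interior_of (T n) \<noteq> {}"
  proof (rule ccontr)
    assume "\<not> ?thesis"
    moreover have "locally_compact_space (top_of_set P)"
      using cs by (rule compact_imp_locally_compact_space)
    ultimately have "top_of_set P interior_of \<Union>(range T) = {}"
      using reg cl by (intro Baire_category_alt) auto
    then show False using un assms(3) interior_of_topspace[of "top_of_set P"] by simp
  qed
  then obtain n x where "x \<in> top_of_set P interior_of (T n)" by blast
  then obtain W where W: "openin (top_of_set P) W" "x \<in> W" "W \<subseteq> T n"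
    by (auto simp: interior_of_def)
  then obtain U where U: "open U" "W = P \<inter> U" by (auto simp: openin_open)
  have near: "\<bar>F n y - f y\<bar> \<le> e / 2" if "y \<in> P \<inter> U" for y
  proof (rule LIMSEQ_le_const2)
    show "(\<lambda>m. \<bar>F n y - F m y\<bar>) \<longlonglongrightarrow> \<bar>F n y - f y\<bar>"
      by (intro tendsto_intros lim)
    have "y \<in> T n" using that U W by auto
    then show "\<exists>N. \<forall>m\<ge>N. \<bar>F n y - F m y\<bar> \<le> e / 2"
      unfolding T_def by auto
  qed
  define V where "V = U \<inter> F n -` {F n x - e / 2<..<F n x + e / 2}"
  have "open V" unfolding V_def by (intro open_Int U open_vimage F) auto
  have "x \<in> V" using U W assms(4) by (auto simp: V_def)
  have V: "\<bar>F n y - f y\<bar> \<le> e / 2 \<and> \<bar>F n y - F n x\<bar> < e / 2" if "y \<in> P \<inter> V" for y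
  proof -
    have "F n x - e / 2 < F n y" "F n y < F n x + e / 2" "y \<in> P \<inter> U"
      using that by (simp_all add: V_def)
    then show ?thesis using near[of y] by linarith
  qed
  have "x \<notin> bder f p e P"
  proof
    assume "x \<in> bder f p e P"
    then have "(\<exists>y\<in>P \<inter> V. p + e \<le> f y) \<and> (\<exists>y\<in>P \<inter> V. f y \<le> p - e)"
      using \<open>open V\<close> \<open>x \<in> V\<close> unfolding bder_iff by simp
    then obtain y z where "y \<in> P \<inter> V" "p + e \<le> f y" "z \<in> P \<inter> V" "f z \<le> p - e"
      by (elim conjE bexE) (rule that)
    then show False using V[of y] V[of z] by linarith
  qed
  then show ?thesis using U W by auto
qed

text \<open>If no stage were empty, each would be strictly larger than its derivative, and some
  cylinder would meet the stage but miss the derivative. These cylinders are distinct for distinct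
  stages, yet there are only countably many.\<close>

lemma titer_bder_empty:
  assumes "baire1 f" "e > 0"
  shows "\<exists>a\<in>Field omega1. titer omega1 (bder f p e) UNIV a = {}"
proof (rule ccontr)
  let ?T = "titer omega1 (bder f p e) UNIV"
  assume ne: "\<not> ?thesis"
  let ?\<B> = "\<Union>n. range (\<lambda>x. cyl x n)"
  have "\<exists>b\<in>?\<B>. b \<inter> ?T a \<noteq> {} \<and> b \<inter> bder f p e (?T a) = {}" if "a \<in> Field omega1" for a
  proof -
    have cl: "closed (?T a)" by (rule closed_titer_bder) simp
    have "bder f p e (?T a) \<noteq> ?T a"
      by (rule bder_proper[OF assms(1) cl _ assms(2)]) (use ne that in blast)
    then obtain x where x: "x \<in> ?T a" "x \<notin> bder f p e (?T a)"
      using optimal_derivative_subset[of "bourgain_family f p e" "?T a"] by blast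
    have "open (- bder f p e (?T a))"
      using closed_optimal_derivative[OF cl] by (rule open_Compl)
    then obtain n where "cyl x n \<subseteq> - bder f p e (?T a)"
      using open_contains_cyl[of "- bder f p e (?T a)" x] x(2) by auto
    moreover have "x \<in> cyl x n \<inter> ?T a" using x(1) by simp
    ultimately show ?thesis by (intro bexI[of _ "cyl x n"]) blast+
  qed
  then obtain \<beta> where \<beta>: "\<And>a. a \<in> Field omega1 \<Longrightarrow>
      \<beta> a \<in> ?\<B> \<and> \<beta> a \<inter> ?T a \<noteq> {} \<and> \<beta> a \<inter> bder f p e (?T a) = {}"
    by metis
  have less: "\<beta> a \<noteq> \<beta> b" if "a \<in> underS omega1 b" for a b
  proof -
    have "?T b \<subseteq> bder f p e (?T a)" by (rule titer_underS_subset[OF Well_order_omega1 that])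
    then show ?thesis using \<beta>[of a] \<beta>[of b] underS_Field_omega1[OF that] by auto
  qed
  have "inj_on \<beta> (Field omega1)"
  proof (rule inj_onI, rule ccontr)
    fix a b assume ab: "a \<in> Field omega1" "b \<in> Field omega1" "\<beta> a = \<beta> b" "a \<noteq> b"
    then have "a \<in> underS omega1 b \<or> b \<in> underS omega1 a"
      using not_le_omega1[of a b] by (auto simp: underS_def)
    then show False using less ab(3) by metis
  qed
  moreover have "countable (\<beta> ` Field omega1)"
    by (rule countable_subset[OF _ countable_cylinders]) (use \<beta> in auto)
  ultimately show False
    using uncountable_Field_omega1 countable_image_inj_on by blast
qed

lemma bourgain_alpha:
  assumes "baire1 f" "e > 0"
  shows bourgain_alpha_Field: "bourgain_alpha f p e \<in> Field omega1"
    and titer_bourgain_alpha: "titer omega1 (bder f p e) UNIV (bourgain_alpha f p e) = {}"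
    and underS_bourgain_alpha: "c \<in> underS omega1 (bourgain_alpha f p e) \<longleftrightarrow>
      c \<in> Field omega1 \<and> titer omega1 (bder f p e) UNIV c \<noteq> {}"
proof -
  let ?T = "titer omega1 (bder f p e) UNIV"
  let ?A = "{i \<in> Field omega1. ?T i = {}}"
  have eq: "bourgain_alpha f p e = wo_rel.minim omega1 ?A"
    unfolding bourgain_alpha_def
    by (rule arg_cong[where f = "wo_rel.minim omega1"]) (auto simp: opt_deriv_seq_eq_titer)
  have sub: "?A \<subseteq> Field omega1" by auto
  have ne: "?A \<noteq> {}" using titer_bder_empty[OF assms, of p] by auto
  have "bourgain_alpha f p e \<in> ?A"
    unfolding eq by (rule wo_rel.minim_in[OF wo_rel_omega1 sub ne])
  then show 1: "bourgain_alpha f p e \<in> Field omega1" and 2: "?T (bourgain_alpha f p e) = {}"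
    by auto
  show "c \<in> underS omega1 (bourgain_alpha f p e) \<longleftrightarrow> c \<in> Field omega1 \<and> ?T c \<noteq> {}"
  proof
    assume c: "c \<in> underS omega1 (bourgain_alpha f p e)"
    have "?T c \<noteq> {}"
    proof
      assume "?T c = {}"
      then have "(bourgain_alpha f p e, c) \<in> omega1"
        unfolding eq
        by (intro wo_rel.minim_least[OF wo_rel_omega1 sub]) (use underS_Field_omega1[OF c] in auto)
      then show False using underS_imp_not_le_omega1[OF c] by blast
    qed
    then show "c \<in> Field omega1 \<and> ?T c \<noteq> {}" using underS_Field_omega1[OF c] by blast
  next
    assume c: "c \<in> Field omega1 \<and> ?T c \<noteq> {}"
    show "c \<in> underS omega1 (bourgain_alpha f p e)"
    proof (rule not_le_omega1)
      show "(bourgain_alpha f p e, c) \<notin> omega1"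
        using titer_antimono[OF Well_order_omega1, of "bourgain_alpha f p e" c "bder f p e" UNIV] 2 c
        by auto
    qed (use 1 c in auto)
  qed
qed

text \<open>The pairs of rationals are countable, so the supremum is a genuine one in
  \<open>omega1\<close> and an ordinal below it is below some \<open>bourgain_alpha\<close>. The
  rank is used only in this form afterwards.\<close>

lemma underS_bourgain_rank:
  assumes "baire1 f"
  shows "c \<in> underS omega1 (bourgain_rank f) \<longleftrightarrow> c \<in> Field omega1 \<and>
    (\<exists>p e. p \<in> \<rat> \<and> e \<in> \<rat> \<and> e > 0 \<and> titer omega1 (bder f p e) UNIV c \<noteq> {})"
proof -
  let ?A = "{bourgain_alpha f p \<epsilon> | p \<epsilon>. p \<in> \<rat> \<and> \<epsilon> \<in> \<rat> \<and> \<epsilon> > 0}"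
  have "?A \<subseteq> (\<lambda>(p, e). bourgain_alpha f p e) ` (\<rat> \<times> \<rat>)" by auto
  then have cA: "countable ?A"
    by (rule countable_subset) (intro countable_image countable_SIGMA countable_rat)
  have sA: "?A \<subseteq> Field omega1" using bourgain_alpha_Field[OF assms] by auto
  have "c \<in> underS omega1 (bourgain_rank f) \<longleftrightarrow> (\<exists>a\<in>?A. c \<in> underS omega1 a)"
    unfolding bourgain_rank_def
    using underS_supr_omega1[OF cA sA, of c] underS_trans_le_omega1[OF supr_omega1_upper[OF cA sA]]
    by blast
  also have "\<dots> \<longleftrightarrow> (\<exists>p e. p \<in> \<rat> \<and> e \<in> \<rat> \<and> e > 0 \<and> c \<in> underS omega1 (bourgain_alpha f p e))"
    by blast
  also have "\<dots> \<longleftrightarrow> c \<in> Field omega1 \<and>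
    (\<exists>p e. p \<in> \<rat> \<and> e \<in> \<rat> \<and> e > 0 \<and> titer omega1 (bder f p e) UNIV c \<noteq> {})"
    using underS_bourgain_alpha[OF assms] by metis
  finally show ?thesis .
qed

lemma finite_max_omega1:
  assumes "finite I" "I \<noteq> {}" "I \<subseteq> Field omega1"
  shows "\<exists>m\<in>I. \<forall>c\<in>I. (c, m) \<in> omega1"
  using assms
proof (induction I rule: finite_ne_induct)
  case (singleton x)
  then show ?case using wo_rel.REFL[OF wo_rel_omega1] by (simp add: refl_on_def)
next
  case (insert x F)
  then obtain m where m: "m \<in> F" "\<forall>c\<in>F. (c, m) \<in> omega1" by auto
  have Fd: "x \<in> Field omega1" "m \<in> Field omega1" using insert m by auto
  show ?case
  proof (cases "(x, m) \<in> omega1")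
    case True
    then show ?thesis using m by (intro bexI[of _ m]) auto
  next
    case False
    then have "m \<in> underS omega1 x" using not_le_omega1 Fd by simp
    then have "(c, x) \<in> omega1" if "c \<in> F" for c
      using m(2) that le_trans_underS_omega1[of c m x] by (simp add: underS_def)
    moreover have "(x, x) \<in> omega1"
      using wo_rel.REFL[OF wo_rel_omega1] Fd by (simp add: refl_on_def)
    ultimately show ?thesis by (intro bexI[of _ x]) auto
  qed
qed

text \<open>Compactness: if the derivatives of all stages below \<open>bourgain_alpha\<close> were
  nonempty, these nested closed sets would have a common point, and it would lie in the stage at
  \<open>bourgain_alpha\<close>.\<close>

lemma titer_bder_last:
  assumes "baire1 f" "e > 0"
  obtains c where "c \<in> Field omega1" "titer omega1 (bder f p e) UNIV c \<noteq> {}"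
    "bder f p e (titer omega1 (bder f p e) UNIV c) = {}"
proof -
  let ?T = "titer omega1 (bder f p e) UNIV"
  let ?a = "bourgain_alpha f p e"
  have "\<exists>c\<in>underS omega1 ?a. bder f p e (?T c) = {}"
  proof (rule ccontr)
    assume ne: "\<not> ?thesis"
    have "UNIV \<inter> (\<Inter>c\<in>underS omega1 ?a. bder f p e (?T c)) \<noteq> {}"
    proof (rule compact_imp_fip_image[OF compact_cantor])
      show "closed (bder f p e (?T c))" for c
        by (intro closed_optimal_derivative closed_titer_bder closed_UNIV)
    next
      fix I assume I: "finite I" "I \<subseteq> underS omega1 ?a"
      show "UNIV \<inter> (\<Inter>c\<in>I. bder f p e (?T c)) \<noteq> {}"
      proof (cases "I = {}")
        case False
        have "I \<subseteq> Field omega1" using I(2) underS_Field_omega1 by auto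
        from finite_max_omega1[OF I(1) False this] I(2)
        obtain m where m: "m \<in> underS omega1 ?a" "\<forall>c\<in>I. (c, m) \<in> omega1"
          by auto
        have "bder f p e (?T m) \<subseteq> bder f p e (?T c)" if "c \<in> I" for c
          using m(2) that by (intro optimal_derivative_mono titer_antimono[OF Well_order_omega1]) auto
        then have "bder f p e (?T m) \<subseteq> (\<Inter>c\<in>I. bder f p e (?T c))" by auto
        moreover have "bder f p e (?T m) \<noteq> {}" using ne m(1) by auto
        ultimately show ?thesis by auto
      qed simp
    qed
    then have "?T ?a \<noteq> {}"
      by (subst titer_unfold[OF Well_order_omega1])
    then show False using titer_bourgain_alpha[OF assms] by blast
  qed
  then obtain c where "c \<in> underS omega1 ?a" "bder f p e (?T c) = {}" by blast
  then show ?thesis using that underS_bourgain_alpha[OF assms] by blast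
qed

text \<open>At a discontinuity \<open>x\<close>, every neighbourhood contains a value at distance at
  least \<open>d\<close> from \<open>g x\<close>. Either such values occur above \<open>g x\<close>
  in every neighbourhood, or below in every one; \<open>x\<close> itself supplies the other side,
  and \<open>p\<close>, \<open>e\<close> are fitted into the gap.\<close>

lemma exists_bder_UNIV_nonempty:
  assumes "\<not> baire0 g"
  shows "\<exists>p e. p \<in> \<rat> \<and> e \<in> \<rat> \<and> e > 0 \<and> bder g p e UNIV \<noteq> {}"
proof -
  obtain x B where B: "open B" "g x \<in> B" "\<And>A. open A \<Longrightarrow> x \<in> A \<Longrightarrow> \<exists>y\<in>A. g y \<notin> B"
    using assms unfolding baire0_def continuous_on_topological by simp metis
  obtain d where d: "d > 0" "\<And>y. dist y (g x) < d \<Longrightarrow> y \<in> B"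
    using B(1,2) unfolding open_dist by (meson that)
  have far: "\<exists>y\<in>U. \<bar>g y - g x\<bar> \<ge> d" if U: "open U" "x \<in> U" for U
  proof -
    obtain y where "y \<in> U" "g y \<notin> B" using B(3)[OF U] by blast
    moreover from this have "\<not> dist (g y) (g x) < d" using d(2)[of "g y"] by blast
    ultimately show ?thesis by (intro bexI[of _ y]) (simp_all add: dist_real_def)
  qed
  \<comment> \<open>For rationals \<open>u < v\<close> between \<open>a\<close> and
    \<open>b\<close>, the midpoint and half the length give \<open>p - e = u\<close> and
    \<open>p + e = v\<close>.\<close>
  have ex: "\<exists>p e. p \<in> \<rat> \<and> e \<in> \<rat> \<and> e > 0 \<and> a \<le> p - e \<and> p + e \<le> b" if "a < b" for a b :: real
  proof -
    obtain u where u: "u \<in> \<rat>" "a < u" "u < b" using Rats_dense_in_real[OF \<open>a < b\<close>] by blast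
    obtain v where v: "v \<in> \<rat>" "u < v" "v < b" using Rats_dense_in_real[OF \<open>u < b\<close>] by blast
    have "(u + v) / 2 \<in> \<rat>" "(v - u) / 2 \<in> \<rat>" using u v by auto
    moreover have "(v - u) / 2 > 0" "a \<le> (u + v) / 2 - (v - u) / 2" "(u + v) / 2 + (v - u) / 2 \<le> b"
      using u v by (auto simp: field_simps)
    ultimately show ?thesis by blast
  qed
  show ?thesis
  proof (cases "\<forall>U. open U \<longrightarrow> x \<in> U \<longrightarrow> (\<exists>y\<in>U. g y \<ge> g x + d)")
    case True
    obtain p e where pe: "p \<in> \<rat>" "e \<in> \<rat>" "e > 0" "g x \<le> p - e" "p + e \<le> g x + d"
      using ex[of "g x" "g x + d"] d(1) by auto
    have "x \<in> bder g p e UNIV"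
      unfolding bder_iff
    proof (intro conjI allI impI)
      fix U assume U: "open U" "x \<in> U"
      then obtain y where "y \<in> U" "g x + d \<le> g y" using True by auto
      then show "\<exists>y\<in>UNIV \<inter> U. p + e \<le> g y" using pe(5) by (intro bexI[of _ y]) auto
      show "\<exists>y\<in>UNIV \<inter> U. g y \<le> p - e" using pe(4) U(2) by (intro bexI[of _ x]) auto
    qed simp
    with pe show ?thesis by blast
  next
    case False
    then obtain V where V: "open V" "x \<in> V" "\<And>y. y \<in> V \<Longrightarrow> g y < g x + d" by (auto simp: not_le)
    have low: "\<exists>y\<in>U. g y \<le> g x - d" if "open U" "x \<in> U" for U
    proof -
      have "open (U \<inter> V)" "x \<in> U \<inter> V" using that V by (auto intro: open_Int)
      from far[OF this] obtain y where y: "y \<in> U \<inter> V" "\<bar>g y - g x\<bar> \<ge> d" by auto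
      then have "g y \<le> g x - d" using V(3)[of y] by auto
      then show ?thesis using y(1) by blast
    qed
    obtain p e where pe: "p \<in> \<rat>" "e \<in> \<rat>" "e > 0" "g x - d \<le> p - e" "p + e \<le> g x"
      using ex[of "g x - d" "g x"] d(1) by auto
    have "x \<in> bder g p e UNIV"
      unfolding bder_iff
    proof (intro conjI allI impI)
      fix U assume U: "open U" "x \<in> U"
      show "\<exists>y\<in>UNIV \<inter> U. p + e \<le> g y" using pe(5) U(2) by (intro bexI[of _ x]) auto
      obtain y where "y \<in> U" "g y \<le> g x - d" using low[OF U] by auto
      then show "\<exists>y\<in>UNIV \<inter> U. g y \<le> p - e" using pe(4) by (intro bexI[of _ y]) auto
    qed simp
    with pe show ?thesis by blast
  qed
qed

section \<open>Constructing reductions\<close>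

lemma continuous_on_cantor_iff:
  fixes k :: "cantor \<Rightarrow> cantor"
  shows "continuous_on UNIV k \<longleftrightarrow> (\<forall>x n. \<exists>m. \<forall>y\<in>cyl x m. k y \<in> cyl (k x) n)"
proof
  assume k: "continuous_on UNIV k"
  show "\<forall>x n. \<exists>m. \<forall>y\<in>cyl x m. k y \<in> cyl (k x) n"
  proof (intro allI)
    fix x n
    have "open (k -` cyl (k x) n)" by (rule open_vimage[OF clopen_cyl(1) k])
    then obtain m where "cyl x m \<subseteq> k -` cyl (k x) n"
      using open_contains_cyl[of "k -` cyl (k x) n" x] by auto
    then show "\<exists>m. \<forall>y\<in>cyl x m. k y \<in> cyl (k x) n" by auto
  qed
next
  assume *: "\<forall>x n. \<exists>m. \<forall>y\<in>cyl x m. k y \<in> cyl (k x) n"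
  show "continuous_on UNIV k"
    unfolding continuous_on_topological
  proof (intro ballI allI impI)
    fix x B assume "open B" "k x \<in> B"
    then obtain n where n: "cyl (k x) n \<subseteq> B" by (rule open_contains_cyl)
    obtain m where m: "\<forall>y\<in>cyl x m. k y \<in> cyl (k x) n" using * by meson
    show "\<exists>A. open A \<and> x \<in> A \<and> (\<forall>y\<in>UNIV. y \<in> A \<longrightarrow> k y \<in> B)"
      by (intro exI[of _ "cyl x m"]) (use m n clopen_cyl in auto)
  qed
qed

text \<open>The level at which a local solution is used is the least possible one. Hence it is constant
  on the cylinder it defines, and the local solutions fit together without a partition of unity.\<close>

lemma glue_and_extend:
  fixes Q :: "cantor set"
  assumes "closed Q"
    and loc: "\<And>x l. cyl x l \<inter> Q = {} \<Longrightarrow>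
      \<exists>m k. continuous_on UNIV k \<and> (\<forall>y\<in>cyl x m. k y \<in> cyl z l \<and> Good y (k y))"
  shows "\<exists>k. continuous_on UNIV k \<and> (\<forall>x\<in>Q. k x = z) \<and> (\<forall>x. x \<notin> Q \<longrightarrow> Good x (k x))"
proof -
  \<comment> \<open>Besides \<open>Good\<close>, the value must lie in the cylinder of length
    \<open>l\<close> around \<open>z\<close> whenever the one around \<open>x\<close> meets
    \<open>Q\<close>; this yields continuity at the points of \<open>Q\<close>.\<close>
  define G where "G x y \<longleftrightarrow> Good x y \<and> (\<forall>l. cyl x l \<inter> Q \<noteq> {} \<longrightarrow> y \<in> cyl z l)" for x y
  define H where "H W k \<longleftrightarrow> continuous_on UNIV k \<and> W \<inter> Q = {} \<and> (\<forall>y\<in>W. G y (k y))"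
    for W and k :: "cantor \<Rightarrow> cantor"
  have ex: "\<exists>m k. H (cyl x m) k" if "x \<notin> Q" for x
  proof -
    have "open (- Q)" using assms(1) by (rule open_Compl)
    then obtain l where "cyl x l \<subseteq> - Q"
      using open_contains_cyl[of "- Q" x] \<open>x \<notin> Q\<close> by auto
    then have l: "cyl x l \<inter> Q = {}" by auto
    from loc[OF this] obtain m k where k: "continuous_on UNIV k"
      "\<forall>y\<in>cyl x m. k y \<in> cyl z l \<and> Good y (k y)" by (elim exE conjE) (rule that)
    let ?M = "max m l"
    have sub: "cyl x ?M \<subseteq> cyl x m" "cyl x ?M \<subseteq> cyl x l" by (auto intro!: cyl_antimono)
    have "G y (k y)" if y: "y \<in> cyl x ?M" for y
      unfolding G_def
    proof (intro conjI allI impI)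
      show "Good y (k y)" using k(2) y sub(1) by auto
      fix l' assume l': "cyl y l' \<inter> Q \<noteq> {}"
      have "cyl y l = cyl x l" using y sub(2) by (intro cyl_eq) auto
      then have "\<not> l \<le> l'" using l l' cyl_antimono[of l l' y] by auto
      then have "cyl z l \<subseteq> cyl z l'" by (intro cyl_antimono) auto
      then show "k y \<in> cyl z l'" using k(2) y sub(1) by auto
    qed
    moreover have "cyl x ?M \<inter> Q = {}" using sub(2) l by auto
    ultimately have "H (cyl x ?M) k" using k(1) by (simp add: H_def)
    then show ?thesis by blast
  qed
  define \<mu> where "\<mu> x = (LEAST m. \<exists>k. H (cyl x m) k)" for x
  \<comment> \<open>\<open>K\<close> depends on the cylinder alone, so that all points sharing it
    are mapped by the same local solution.\<close>
  define K where "K W = (SOME k. H W k)" for W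
  have \<mu>: "H (cyl x (\<mu> x)) (K (cyl x (\<mu> x)))" if "x \<notin> Q" for x
  proof -
    have "\<exists>k. H (cyl x (\<mu> x)) k" unfolding \<mu>_def using ex[OF that] by (rule LeastI_ex)
    then show ?thesis unfolding K_def by (rule someI_ex)
  qed
  have \<mu>_eq: "\<mu> y = \<mu> x" if "x \<notin> Q" "y \<in> cyl x (\<mu> x)" for x y
  proof (rule antisym)
    have e1: "cyl y (\<mu> x) = cyl x (\<mu> x)" using that(2) by (rule cyl_eq)
    then have "\<exists>k. H (cyl y (\<mu> x)) k" using \<mu>[OF that(1)] by auto
    then show le: "\<mu> y \<le> \<mu> x" unfolding \<mu>_def[of y] by (rule Least_le)
    have "y \<notin> Q" using \<mu>[OF that(1)] that(2) by (auto simp: H_def)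
    have "cyl y (\<mu> y) = cyl x (\<mu> y)"
      using that(2) cyl_antimono[OF le, of x] by (intro cyl_eq) auto
    then have "\<exists>k. H (cyl x (\<mu> y)) k" using \<mu>[OF \<open>y \<notin> Q\<close>] by auto
    then show "\<mu> x \<le> \<mu> y" unfolding \<mu>_def[of x] by (rule Least_le)
  qed
  define k where "k x = (if x \<in> Q then z else K (cyl x (\<mu> x)) x)" for x
  have kG: "G x (k x)" if "x \<notin> Q" for x
    using \<mu>[OF that] that by (simp add: H_def k_def)
  have "continuous_on UNIV k"
    unfolding continuous_on_cantor_iff
  proof (intro allI)
    fix x n
    show "\<exists>m. \<forall>y\<in>cyl x m. k y \<in> cyl (k x) n"
    proof (cases "x \<in> Q")
      case True
      have "k y \<in> cyl z n" if y: "y \<in> cyl x n" for y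
      proof (cases "y \<in> Q")
        case False
        have "x \<in> cyl y n" using cyl_eq[OF y] by simp
        then show ?thesis using kG[OF False] True unfolding G_def by auto
      qed (simp add: k_def)
      moreover have "k x = z" using True by (simp add: k_def)
      ultimately show ?thesis by auto
    next
      case False
      let ?k = "K (cyl x (\<mu> x))"
      have "continuous_on UNIV ?k" using \<mu>[OF False] by (simp add: H_def)
      then obtain m where m: "\<forall>y\<in>cyl x m. ?k y \<in> cyl (?k x) n"
        unfolding continuous_on_cantor_iff by meson
      have "k y \<in> cyl (k x) n" if "y \<in> cyl x (max m (\<mu> x))" for y
      proof -
        have y: "y \<in> cyl x m" "y \<in> cyl x (\<mu> x)"
          using that cyl_antimono[of m "max m (\<mu> x)" x] cyl_antimono[of "\<mu> x" "max m (\<mu> x)" x] by auto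
        have "y \<notin> Q" using \<mu>[OF False] y(2) by (auto simp: H_def)
        then have "k y = ?k y" using \<mu>_eq[OF False y(2)] cyl_eq[OF y(2)] by (simp add: k_def)
        moreover have "k x = ?k x" using False by (simp add: k_def)
        ultimately show ?thesis using m y(1) by simp
      qed
      then show ?thesis by blast
    qed
  qed
  moreover have "\<forall>x\<in>Q. k x = z" by (simp add: k_def)
  moreover have "\<forall>x. x \<notin> Q \<longrightarrow> Good x (k x)" using kG by (simp add: G_def)
  ultimately show ?thesis by blast
qed

text \<open>A point outside \<open>P\<close> counts as removed; a neighbourhood of it that misses
  \<open>P\<close> satisfies both alternatives vacuously.\<close>

lemma not_bder_locally:
  assumes "closed P" "x \<notin> bder f p e P"
  obtains n where "\<forall>y\<in>P \<inter> cyl x n. f y < p + e" | n where "\<forall>y\<in>P \<inter> cyl x n. p - e < f y"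
proof -
  have "\<exists>U. open U \<and> x \<in> U \<and> ((\<forall>y\<in>P \<inter> U. f y < p + e) \<or> (\<forall>y\<in>P \<inter> U. p - e < f y))"
  proof (cases "x \<in> P")
    case True
    then show ?thesis using assms(2) unfolding bder_iff by (auto simp: not_le)
  next
    case False
    then show ?thesis by (intro exI[of _ "- P"]) (use assms(1) in auto)
  qed
  then obtain U where U: "open U" "x \<in> U"
    "(\<forall>y\<in>P \<inter> U. f y < p + e) \<or> (\<forall>y\<in>P \<inter> U. p - e < f y)"
    by (elim exE conjE) (rule that)
  obtain n where n: "cyl x n \<subseteq> U" using open_contains_cyl[OF U(1,2)] .
  from U(3) show ?thesis
  proof
    assume "\<forall>y\<in>P \<inter> U. f y < p + e"
    with n have "\<forall>y\<in>P \<inter> cyl x n. f y < p + e" by auto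
    then show ?thesis by (rule that(1))
  next
    assume "\<forall>y\<in>P \<inter> U. p - e < f y"
    with n have "\<forall>y\<in>P \<inter> cyl x n. p - e < f y" by auto
    then show ?thesis by (rule that(2))
  qed
qed

text \<open>The point \<open>y\<close> forces the answer about \<open>g\<close>, and the forced bit
  is correct for \<open>f\<close> at \<open>x\<close>: \<open>q + d \<le> g y\<close> excludes bit 1
  while \<open>p - e < f x\<close> makes bit 0 correct, and dually.\<close>

definition decides ::
  "(cantor \<Rightarrow> real) \<Rightarrow> real \<Rightarrow> real \<Rightarrow> (cantor \<Rightarrow> real) \<Rightarrow> real \<Rightarrow> real \<Rightarrow> cantor \<Rightarrow> cantor \<Rightarrow> bool" where
  "decides f p e g q d x y \<longleftrightarrow> p - e < f x \<and> q + d \<le> g y \<or> f x < p + e \<and> g y \<le> q - d"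

lemma correct_answer_decides:
  "decides f p e g q d x y \<Longrightarrow> correct_answer b (g y) q d \<Longrightarrow> correct_answer b (f x) p e"
  by (auto simp: decides_def correct_answer_def)

text \<open>Outside the \<open>a\<close>-th stage a point is removed at some \<open>b\<close> below
  \<open>a\<close>, so one bit is correct for \<open>f\<close> on stage \<open>b\<close> near it. As
  \<open>z\<close> survives the derivative of stage \<open>b\<close> of \<open>g\<close>, a nearby
  \<open>y\<close> in that stage forces this bit. The induction continues from \<open>y\<close> with
  the smaller index \<open>b\<close>. The bound \<open>N\<close> keeps the maps close to
  \<open>z\<close>, as gluing requires.\<close>

lemma block_reduction:
  assumes "closed C" and "z \<in> titer omega1 (bder g q d) UNIV a"
  shows "\<exists>k. continuous_on UNIV k \<and> (\<forall>x\<in>titer omega1 (bder f p e) C a. k x = z) \<and>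
    (\<forall>x. k x \<in> cyl z N) \<and>
    (\<forall>x\<in>C - titer omega1 (bder f p e) C a. decides f p e g q d x (k x))"
  using assms(2)
proof (induction a arbitrary: z N rule: Well_order_induct_underS[OF Well_order_omega1])
  case (1 a)
  let ?Q = "titer omega1 (bder f p e) C" and ?R = "titer omega1 (bder g q d) UNIV"
  let ?Good = "\<lambda>x y. y \<in> cyl z N \<and> (x \<in> C \<longrightarrow> decides f p e g q d x y)"
  have clQ: "closed (?Q b)" for b by (rule closed_titer_bder[OF assms(1)])
  have "\<exists>k. continuous_on UNIV k \<and> (\<forall>x\<in>?Q a. k x = z) \<and> (\<forall>x. x \<notin> ?Q a \<longrightarrow> ?Good x (k x))"
  proof (rule glue_and_extend[OF clQ])
    fix x l assume l: "cyl x l \<inter> ?Q a = {}"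
    let ?N = "max N l"
    have sub: "cyl z ?N \<subseteq> cyl z l" "cyl z ?N \<subseteq> cyl z N" by (auto intro!: cyl_antimono)
    have "x \<notin> ?Q a" using l self_mem_cyl[of x l] by blast
    then consider "x \<notin> C" | b where "b \<in> underS omega1 a" "x \<notin> bder f p e (?Q b)"
      unfolding titer_unfold[OF Well_order_omega1, of "bder f p e" C a] by auto
    then show "\<exists>m k. continuous_on UNIV k \<and> (\<forall>y\<in>cyl x m. k y \<in> cyl z l \<and> ?Good y (k y))"
    proof cases
      case 1
      have "open (- C)" using assms(1) by (rule open_Compl)
      then obtain m where "cyl x m \<subseteq> - C" using open_contains_cyl[of "- C" x] 1 by auto
      then show ?thesis
        by (intro exI[of _ m] exI[of _ "\<lambda>_. z"]) auto
    next
      case (2 b)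
      have z: "z \<in> bder g q d (?R b)"
        using titer_underS_subset[OF Well_order_omega1 2(1), of "bder g q d" UNIV] "1.prems" by auto
      have near: "(\<exists>y\<in>?R b \<inter> cyl z ?N. q + d \<le> g y) \<and> (\<exists>y\<in>?R b \<inter> cyl z ?N. g y \<le> q - d)"
        using z clopen_cyl(1)[of z ?N] self_mem_cyl[of z ?N] unfolding bder_iff by simp
      obtain m y where y: "y \<in> ?R b" "y \<in> cyl z ?N"
        and dec: "\<forall>x'\<in>?Q b \<inter> cyl x m. decides f p e g q d x' y"
        using clQ[of b] 2(2)
      proof (rule not_bder_locally)
        fix n assume n: "\<forall>y\<in>?Q b \<inter> cyl x n. f y < p + e"
        obtain y where "y \<in> ?R b \<inter> cyl z ?N" "g y \<le> q - d" using near by blast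
        then show thesis using n by (intro that[of y n]) (auto simp: decides_def)
      next
        fix n assume n: "\<forall>y\<in>?Q b \<inter> cyl x n. p - e < f y"
        obtain y where "y \<in> ?R b \<inter> cyl z ?N" "q + d \<le> g y" using near by blast
        then show thesis using n by (intro that[of y n]) (auto simp: decides_def)
      qed
      \<comment> \<open>This map sends \<open>?Q b\<close> to \<open>y\<close>, where
        \<open>dec\<close> gives the answer, and handles \<open>C - ?Q b\<close> itself.\<close>
      from "1.IH"[OF 2(1) y(1), of ?N] obtain k where k: "continuous_on UNIV k"
        "\<forall>x\<in>?Q b. k x = y" "\<forall>x. k x \<in> cyl y ?N"
        "\<forall>x\<in>C - ?Q b. decides f p e g q d x (k x)"
        by (elim exE conjE) (rule that)
      have "k x' \<in> cyl z l \<and> ?Good x' (k x')" if x': "x' \<in> cyl x m" for x'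
      proof -
        have "k x' \<in> cyl z ?N" using k(3) cyl_eq[OF y(2)] by simp
        moreover have "decides f p e g q d x' (k x')" if "x' \<in> C"
          using dec k(2,4) that x' by (cases "x' \<in> ?Q b") auto
        ultimately show ?thesis using sub by auto
      qed
      with k(1) show ?thesis by blast
    qed
  qed
  then obtain k where k: "continuous_on UNIV k" "\<forall>x\<in>?Q a. k x = z"
    "\<forall>x. x \<notin> ?Q a \<longrightarrow> ?Good x (k x)"
    by (elim exE conjE) (rule that)
  have "k x \<in> cyl z N" for x using k(2,3) by (cases "x \<in> ?Q a") auto
  with k show ?case by (intro exI[of _ k]) auto
qed

text \<open>Arbitrarily close to \<open>z\<close> there are points where \<open>g\<close> is far
  from \<open>g z\<close>. Gluing sends \<open>C\<close> to \<open>z\<close> and everything else to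
  such points. The question and the marking bit \<open>s\<close> are fixed before \<open>C\<close>;
  only the map varies with it.\<close>

lemma closed_set_question:
  assumes "z \<in> bder g q d UNIV" "q \<in> \<rat>" "d \<in> \<rat>" "d > 0"
  obtains q' d' s where "q' \<in> \<rat>" "d' \<in> \<rat>" "d' > 0"
    "\<And>C :: cantor set. closed C \<Longrightarrow> \<exists>k. continuous_on UNIV k \<and>
      (\<forall>x b. correct_answer b (g (k x)) q' d' \<longrightarrow> (b = s \<longleftrightarrow> x \<in> C))"
proof -
  have near: "(\<exists>y\<in>cyl z l. q + d \<le> g y) \<and> (\<exists>y\<in>cyl z l. g y \<le> q - d)" for l
    using assms(1) clopen_cyl(1)[of z l] self_mem_cyl[of z l] unfolding bder_iff by simp
  have ex: "\<exists>k. continuous_on UNIV k \<and> (\<forall>x\<in>C. k x = z) \<and> (\<forall>x. x \<notin> C \<longrightarrow> Q (k x))"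
    if C: "closed C" and Q: "\<And>l. \<exists>y\<in>cyl z l. Q y" for C :: "cantor set" and Q :: "cantor \<Rightarrow> bool"
  proof (rule glue_and_extend[OF C, where Good = "\<lambda>x. Q"])
    fix x :: cantor and l
    obtain y where "y \<in> cyl z l" "Q y" using Q by blast
    then show "\<exists>m k. continuous_on UNIV k \<and> (\<forall>x'\<in>cyl x m. k x' \<in> cyl z l \<and> Q (k x'))"
      by (intro exI[of _ 0] exI[of _ "\<lambda>_. y"]) auto
  qed
  show ?thesis
  proof (cases "q \<le> g z")
    case True
    show ?thesis
    \<comment> \<open>The thresholds become \<open>q - d\<close> and \<open>q\<close>: on
      \<open>C\<close> the value \<open>g z \<ge> q\<close> rules out bit 1, off \<open>C\<close> a
      value at most \<open>q - d\<close> rules out bit 0.\<close>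
    proof (rule that[of "q - d / 2" "d / 2" False])
      fix C :: "cantor set" assume "closed C"
      from ex[OF this, of "\<lambda>y. g y \<le> q - d"] near
      obtain k where k: "continuous_on UNIV k" "\<forall>x\<in>C. k x = z" "\<forall>x. x \<notin> C \<longrightarrow> g (k x) \<le> q - d"
        by auto
      have "b = False \<longleftrightarrow> x \<in> C" if "correct_answer b (g (k x)) (q - d / 2) (d / 2)" for x b
        using that k(2,3) True assms(4) by (cases "x \<in> C") (force simp: correct_answer_def)+
      with k(1) show "\<exists>k. continuous_on UNIV k \<and>
          (\<forall>x b. correct_answer b (g (k x)) (q - d / 2) (d / 2) \<longrightarrow> (b = False \<longleftrightarrow> x \<in> C))"
        by blast
    qed (use assms in auto)
  next
    case False
    show ?thesis
    proof (rule that[of "q + d / 2" "d / 2" True])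
      fix C :: "cantor set" assume "closed C"
      from ex[OF this, of "\<lambda>y. q + d \<le> g y"] near
      obtain k where k: "continuous_on UNIV k" "\<forall>x\<in>C. k x = z" "\<forall>x. x \<notin> C \<longrightarrow> q + d \<le> g (k x)"
        by auto
      have "b = True \<longleftrightarrow> x \<in> C" if "correct_answer b (g (k x)) (q + d / 2) (d / 2)" for x b
        using that k(2,3) False assms(4) by (cases "x \<in> C") (force simp: correct_answer_def)+
      with k(1) show "\<exists>k. continuous_on UNIV k \<and>
          (\<forall>x b. correct_answer b (g (k x)) (q + d / 2) (d / 2) \<longrightarrow> (b = True \<longleftrightarrow> x \<in> C))"
        by blast
    qed (use assms in auto)
  qed
qed

section \<open>From the comparison of ranks to a reduction\<close>

lemma Well_order_ord_of: "Well_order (ord_of a)"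
  unfolding ord_of_def by (rule Well_order_Restr[OF Well_order_omega1])

lemma Titer_ord_of: "Titer (ord_of a) D = (\<lambda>P. titer omega1 D P a)"
  unfolding ord_of_def by (rule ext) (rule Titer_Restr_underS[OF Well_order_omega1])

lemma Titer_ord_of_times: "Titer (ord_times_nat (ord_of a) n) D P = ((\<lambda>P. titer omega1 D P a) ^^ n) P"
  by (simp add: Titer_ord_times_nat[OF Well_order_ord_of] Titer_ord_of)

lemma coarsening_imp_tt_reducible:
  assumes f: "baire1 f" and g: "baire1 g"
    and le: "ord_coarsening (bourgain_rank f) (bourgain_rank g)"
  shows "tt_reducible f g"
  unfolding tt_reducible_def
proof (intro allI impI, elim conjE)
  fix p e :: real assume pe: "p \<in> \<rat>" "e \<in> \<rat>" "e > 0"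
  obtain c where c: "c \<in> Field omega1" "titer omega1 (bder f p e) UNIV c \<noteq> {}"
    "bder f p e (titer omega1 (bder f p e) UNIV c) = {}"
    using titer_bder_last[OF f pe(3)] .
  have "c \<in> underS omega1 (bourgain_rank f)"
    unfolding underS_bourgain_rank[OF f] using c pe by blast
  then obtain a n where a: "a \<in> underS omega1 (bourgain_rank g)"
    and less: "ord_of c <o ord_times_nat (ord_of a) n"
    using le unfolding ord_coarsening_def by blast
  define C where "C i = ((\<lambda>P. titer omega1 (bder f p e) P a) ^^ i) UNIV" for i
  have C0: "C 0 = UNIV" and CSuc: "C (Suc i) = titer omega1 (bder f p e) (C i) a" for i
    by (simp_all add: C_def)
  \<comment> \<open>As \<open>c\<close> is below the \<open>n\<close>-fold multiple of
    \<open>a\<close>, stage \<open>C n\<close> lies in the derivative of the last nonempty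
    stage.\<close>
  have "C n \<subseteq> bder f p e (titer omega1 (bder f p e) UNIV c)"
    using Titer_ordLess[OF less, of "bder f p e" UNIV]
    unfolding Titer_ord_of_times Titer_ord_of C_def .
  with c(3) have Cn: "C n = {}" by simp
  have Ccl: "closed (C i)" for i
    by (induction i) (simp_all add: C0 CSuc closed_titer_bder)
  obtain q d where qd: "q \<in> \<rat>" "d \<in> \<rat>" "d > 0" "titer omega1 (bder g q d) UNIV a \<noteq> {}"
    using a unfolding underS_bourgain_rank[OF g] by blast
  then obtain z where z: "z \<in> titer omega1 (bder g q d) UNIV a" by blast
  \<comment> \<open>Iterating with index 0 would never remove anything. An index below
    \<open>a\<close> then places \<open>z\<close> in the first derivative of
    \<open>g\<close>.\<close>
  have "underS omega1 a \<noteq> {}"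
  proof
    assume "underS omega1 a = {}"
    then have "titer omega1 (bder f p e) P a = P" for P
      by (subst titer_unfold[OF Well_order_omega1]) simp
    then have "C i = UNIV" for i by (induction i) (simp_all add: C0 CSuc)
    with Cn show False by simp
  qed
  then obtain b where b: "b \<in> underS omega1 a" by blast
  have "z \<in> bder g q d (titer omega1 (bder g q d) UNIV b)"
    using titer_underS_subset[OF Well_order_omega1 b] z by (rule subsetD)
  then have "z \<in> bder g q d UNIV"
    by (rule subsetD[OF optimal_derivative_mono[OF subset_UNIV]])
  then obtain q' d' s where q': "q' \<in> \<rat>" "d' \<in> \<rat>" "d' > 0" and
    tst: "\<And>C :: cantor set. closed C \<Longrightarrow> \<exists>k. continuous_on UNIV k \<and>
      (\<forall>x b. correct_answer b (g (k x)) q' d' \<longrightarrow> (b = s \<longleftrightarrow> x \<in> C))"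
    using closed_set_question[OF _ qd(1-3)] by metis
  have "\<forall>i. \<exists>k. continuous_on UNIV k \<and>
      (\<forall>x b. correct_answer b (g (k x)) q' d' \<longrightarrow> (b = s \<longleftrightarrow> x \<in> C i))"
    using tst[OF Ccl] by simp
  then obtain kt where kt: "\<And>i. continuous_on UNIV (kt i)"
    "\<And>i x b. correct_answer b (g (kt i x)) q' d' \<Longrightarrow> b = s \<longleftrightarrow> x \<in> C i"
    by metis
  have "\<forall>i. \<exists>k. continuous_on UNIV k \<and> (\<forall>x\<in>C i - C (Suc i). decides f p e g q d x (k x))"
  proof
    fix i
    from block_reduction[OF Ccl[of i] z, of f p e 0]
    show "\<exists>k. continuous_on UNIV k \<and> (\<forall>x\<in>C i - C (Suc i). decides f p e g q d x (k x))"
      unfolding CSuc by (elim exE conjE) (intro exI conjI)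
  qed
  then obtain kb where kb: "\<And>i. continuous_on UNIV (kb i)"
    "\<And>i x. x \<in> C i - C (Suc i) \<Longrightarrow> decides f p e g q d x (kb i x)"
    by metis
  \<comment> \<open>Questions \<open>0, ..., n - 1\<close> test membership in the sets
    \<open>C i\<close>; questions \<open>n, ..., 2 * n - 1\<close> treat the blocks
    \<open>C i - C (Suc i)\<close>.\<close>
  define Q where "Q i = (if i < n then q' else q)" for i
  define E where "E i = (if i < n then d' else d)" for i
  define K where "K i = (if i < n then kt i else kb (i - n))" for i
  \<comment> \<open>The last \<open>i\<close> whose test is positive names the block of the input,
    and the answer for that block is returned.\<close>
  define h where "h \<sigma> = \<sigma> ! (n + Max {i. i < n \<and> \<sigma> ! i = s})" for \<sigma>
  have correct: "correct_answer (h \<sigma>) (f A) p e"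
    if \<sigma>: "\<forall>i<2 * n. correct_answer (\<sigma> ! i) (g (K i A)) (Q i) (E i)" for A \<sigma>
  proof -
    have "\<sigma> ! i = s \<longleftrightarrow> A \<in> C i" if "i < n" for i
      using \<sigma>[rule_format, of i] kt(2)[of "\<sigma> ! i" i A] that by (simp add: K_def Q_def E_def)
    then have eq: "{i. i < n \<and> \<sigma> ! i = s} = {i. i < n \<and> A \<in> C i}" by auto
    define I where "I = Max {i. i < n \<and> A \<in> C i}"
    have fin: "finite {i. i < n \<and> A \<in> C i}" by simp
    have "n \<noteq> 0" using Cn C0 by (cases n) auto
    then have "0 \<in> {i. i < n \<and> A \<in> C i}" using C0 by simp
    then have "I \<in> {i. i < n \<and> A \<in> C i}" unfolding I_def using fin by (intro Max_in) auto
    then have I: "I < n" "A \<in> C I" by auto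
    have "A \<notin> C (Suc I)"
    proof
      assume A: "A \<in> C (Suc I)"
      then have "Suc I \<noteq> n" using Cn by auto
      then have "Suc I \<in> {i. i < n \<and> A \<in> C i}" using A I(1) by simp
      then have "Suc I \<le> I" unfolding I_def by (intro Max_ge fin) (simp add: I_def)
      then show False by simp
    qed
    then have "decides f p e g q d A (kb I A)" using I(2) by (intro kb(2)) simp
    moreover have "correct_answer (\<sigma> ! (n + I)) (g (kb I A)) q d"
      using \<sigma>[rule_format, of "n + I"] I(1) by (simp add: K_def Q_def E_def)
    ultimately have "correct_answer (\<sigma> ! (n + I)) (f A) p e" by (rule correct_answer_decides)
    then show ?thesis unfolding h_def eq I_def .
  qed
  show "\<exists>r q \<delta> k h. (\<forall>i<r. q i \<in> \<rat> \<and> \<delta> i \<in> \<rat> \<and> \<delta> i > 0 \<and> continuous_on UNIV (k i)) \<and>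
      (\<forall>A \<sigma>. length \<sigma> = r \<and> (\<forall>i<r. correct_answer (\<sigma> ! i) (g (k i A)) (q i) (\<delta> i))
        \<longrightarrow> correct_answer (h \<sigma>) (f A) p e)"
  proof (intro exI conjI allI impI)
    show "Q i \<in> \<rat>" "E i \<in> \<rat>" "E i > 0" "continuous_on UNIV (K i)" if "i < 2 * n" for i
      using qd q' kt(1) kb(1) by (simp_all add: Q_def E_def K_def)
    show "correct_answer (h \<sigma>) (f A) p e"
      if "length \<sigma> = 2 * n \<and> (\<forall>i<2 * n. correct_answer (\<sigma> ! i) (g (K i A)) (Q i) (E i))" for A \<sigma>
      using that by (intro correct) simp
  qed
qed

section \<open>Bounding the rank of a reducible function\<close>

lemma funpow_antimono_of_decreasing:
  assumes "\<And>A. G A \<subseteq> (A :: 'a set)" "m \<le> n"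
  shows "(G ^^ n) P \<subseteq> (G ^^ m) P"
  using assms(2)
proof (induction n rule: dec_induct)
  case (step n)
  then show ?case using assms(1)[of "(G ^^ n) P"] by auto
qed simp

text \<open>\<open>G i\<close> need not distribute over unions, so the naive induction on \<open>N\<close> fails. Instead one looks
  at the multiplicities \<open>b i\<close> of \<open>x\<close> for \<open>G i\<close>: near \<open>x\<close> they can only drop, so if their sum is at
  most \<open>N\<close> they are locally constant on the \<open>N\<close>-th iterate of \<open>F\<close>, and one more application of \<open>F\<close> removes \<open>x\<close>.\<close>

lemma funpow_multiplicities:
  fixes F :: "cantor set \<Rightarrow> cantor set" and G :: "nat \<Rightarrow> cantor set \<Rightarrow> cantor set"
  assumes G_mono: "\<And>i A B. A \<subseteq> B \<Longrightarrow> G i A \<subseteq> G i B"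
    and G_le: "\<And>i A. G i A \<subseteq> A"
    and G_closed: "\<And>i A. closed A \<Longrightarrow> closed (G i A)"
    and F_closed: "\<And>A. closed A \<Longrightarrow> closed (F A)"
    and F_loc: "\<And>A U. open U \<Longrightarrow> F A \<inter> U \<subseteq> F (A \<inter> U)"
    and FG: "\<And>A. closed A \<Longrightarrow> F A \<subseteq> (\<Union>i<r. G i A)"
    and P: "closed P" and x: "x \<in> (F ^^ N) P"
    and F_le: "\<And>A. F A \<subseteq> A"
  shows "\<exists>a. N \<le> (\<Sum>i<r. a i) \<and> (\<forall>i<r. x \<in> (G i ^^ a i) P)"
  using x
proof (induction N arbitrary: x)
  case 0
  then show ?case by (intro exI[of _ "\<lambda>_. 0"]) simp
next
  case (Suc N)
  have "x \<in> P" using Suc.prems funpow_antimono_of_decreasing[OF F_le, of 0 "Suc N" P] by auto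
  have cl: "closed ((G i ^^ n) P)" for i n
    by (induction n) (simp_all add: P G_closed)
  show ?case
  \<comment> \<open>If \<open>x\<close> survives all finite iterates of one \<open>G i\<close>, that
    index alone can carry the whole sum.\<close>
  proof (cases "\<exists>i<r. \<forall>n. x \<in> (G i ^^ n) P")
    case True
    then obtain i where i: "i < r" "\<And>n. x \<in> (G i ^^ n) P" by blast
    have "(\<Sum>j<r. if j = i then Suc N else 0) = Suc N" using i(1) by simp
    moreover have "\<forall>j<r. x \<in> (G j ^^ (if j = i then Suc N else 0)) P"
      using i(2)[of "Suc N"] \<open>x \<in> P\<close> by simp
    ultimately show ?thesis
      by (intro exI[of _ "\<lambda>j. if j = i then Suc N else 0"]) simp
  next
    case False
    have "\<forall>i. \<exists>n. i < r \<longrightarrow> x \<in> (G i ^^ n) P \<and> x \<notin> (G i ^^ Suc n) P"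
    proof
      fix i
      show "\<exists>n. i < r \<longrightarrow> x \<in> (G i ^^ n) P \<and> x \<notin> (G i ^^ Suc n) P"
      proof (cases "i < r")
        case True
        show ?thesis
        proof (rule ccontr)
          assume "\<not> ?thesis"
          then have step: "x \<in> (G i ^^ Suc n) P" if "x \<in> (G i ^^ n) P" for n using that by blast
          have "x \<in> (G i ^^ n) P" for n
          proof (induction n)
            case (Suc n)
            then show ?case by (rule step)
          qed (simp add: \<open>x \<in> P\<close>)
          with True False show False by blast
        qed
      qed simp
    qed
    then obtain b where b: "\<And>i. i < r \<Longrightarrow> x \<in> (G i ^^ b i) P"
      "\<And>i. i < r \<Longrightarrow> x \<notin> (G i ^^ Suc (b i)) P"
      by metis
    show ?thesis
    proof (cases "Suc N \<le> (\<Sum>i<r. b i)")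
      case True
      then show ?thesis using b(1) by blast
    next
      case small: False
      let ?W = "\<Inter>i\<in>{..<r}. - (G i ^^ Suc (b i)) P"
      have "open ?W" by (intro open_INT ballI open_Compl cl) simp
      moreover have "x \<in> ?W" using b(2) by auto
      ultimately obtain l where l: "cyl x l \<subseteq> ?W" by (rule open_contains_cyl)
      let ?Q = "(F ^^ N) P \<inter> cyl x l"
      have "closed ((F ^^ N) P)" by (induction N) (simp_all add: P F_closed)
      then have "closed ?Q" by (intro closed_Int clopen_cyl)
      have Q: "y \<in> (G i ^^ b i) P" if y: "y \<in> ?Q" and "i < r" for y i
      proof -
        obtain a where a: "N \<le> (\<Sum>i<r. a i)" "\<And>i. i < r \<Longrightarrow> y \<in> (G i ^^ a i) P"
          using Suc.IH[of y] y by blast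
        have ab: "a j \<le> b j" if "j < r" for j
        proof (rule ccontr)
          assume "\<not> a j \<le> b j"
          then have "(G j ^^ a j) P \<subseteq> (G j ^^ Suc (b j)) P"
            by (intro funpow_antimono_of_decreasing G_le) simp
          moreover have "y \<notin> (G j ^^ Suc (b j)) P" using y l that by auto
          ultimately show False using a(2)[OF that] by blast
        qed
        have "a i = b i"
        proof (rule ccontr)
          assume "a i \<noteq> b i"
          then have "a i < b i" using ab[OF \<open>i < r\<close>] by simp
          then have "(\<Sum>i<r. a i) < (\<Sum>i<r. b i)"
            using \<open>i < r\<close> ab by (intro sum_strict_mono_ex1 bexI[of _ i]) auto
          then show False using a(1) small by simp
        qed
        then show ?thesis using a(2)[OF \<open>i < r\<close>] by simp
      qed
      have "x \<in> F ((F ^^ N) P) \<inter> cyl x l" using Suc.prems by simp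
      \<comment> \<open>Locality restricts the last application of \<open>F\<close> to
        \<open>?Q\<close>, all of whose points lie in the \<open>b i\<close>-th iterate of each
        \<open>G i\<close>.\<close>
      then have "x \<in> F ?Q" by (rule subsetD[OF F_loc[OF clopen_cyl(1)]])
      then obtain i where i: "i < r" "x \<in> G i ?Q" using FG[OF \<open>closed ?Q\<close>] by auto
      have "G i ?Q \<subseteq> G i ((G i ^^ b i) P)" using Q i(1) by (intro G_mono) auto
      then have "x \<in> (G i ^^ Suc (b i)) P" using i(2) by auto
      with b(2)[OF i(1)] show ?thesis by blast
    qed
  qed
qed

text \<open>Pigeonhole on the multiplicities: if all were below \<open>m\<close>, their sum would be
  at most \<open>r * m\<close>. The extra 1 covers \<open>r = 0\<close>, where the union is
  empty.\<close>

lemma funpow_subset_union: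
  fixes F :: "cantor set \<Rightarrow> cantor set" and G :: "nat \<Rightarrow> cantor set \<Rightarrow> cantor set"
  assumes "\<And>i A B. A \<subseteq> B \<Longrightarrow> G i A \<subseteq> G i B"
    and G_le: "\<And>i A. G i A \<subseteq> A"
    and "\<And>i A. closed A \<Longrightarrow> closed (G i A)"
    and "\<And>A. closed A \<Longrightarrow> closed (F A)"
    and "\<And>A U. open U \<Longrightarrow> F A \<inter> U \<subseteq> F (A \<inter> U)"
    and "\<And>A. closed A \<Longrightarrow> F A \<subseteq> (\<Union>i<r. G i A)"
    and "closed P" and F_le: "\<And>A. F A \<subseteq> A"
  shows "(F ^^ (r * m + 1)) P \<subseteq> (\<Union>i<r. (G i ^^ m) P)"
proof
  fix x assume x: "x \<in> (F ^^ (r * m + 1)) P"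
  obtain a where a: "r * m + 1 \<le> (\<Sum>i<r. a i)" "\<forall>i<r. x \<in> (G i ^^ a i) P"
    using funpow_multiplicities[OF assms(1-7) x F_le] by blast
  have "\<exists>i<r. m \<le> a i"
  proof (rule ccontr)
    assume "\<not> ?thesis"
    then have "(\<Sum>i<r. a i) \<le> (\<Sum>i<r. m)" by (intro sum_mono) (auto simp: not_le less_imp_le)
    with a(1) show False by simp
  qed
  then obtain i where i: "i < r" "m \<le> a i" by blast
  then have "x \<in> (G i ^^ m) P"
    using a(2) funpow_antimono_of_decreasing[of "G i", OF G_le i(2), of P] by blast
  with i show "x \<in> (\<Union>i<r. (G i ^^ m) P)" by blast
qed

text \<open>If every \<open>i\<close> failed at some \<open>w i\<close>, all would fail at the
  largest of these ordinals. So an \<open>i\<close> chosen for each ordinal separately can be chosen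
  once for all.\<close>

lemma finite_union_of_chains:
  assumes "Z \<noteq> {}" "Z \<subseteq> Field omega1"
    and anti: "\<And>i a b. (a, b) \<in> omega1 \<Longrightarrow> R i b \<Longrightarrow> R i a"
    and ex: "\<And>z. z \<in> Z \<Longrightarrow> \<exists>i<(r::nat). R i z"
  shows "\<exists>i<r. \<forall>z\<in>Z. R i z"
proof (rule ccontr)
  assume "\<not> ?thesis"
  then have "\<forall>i\<in>{..<r}. \<exists>z\<in>Z. \<not> R i z" by blast
  then obtain w where w: "\<And>i. i < r \<Longrightarrow> w i \<in> Z \<and> \<not> R i (w i)"
    by (metis lessThan_iff)
  obtain z0 where "z0 \<in> Z" using assms(1) by blast
  \<comment> \<open>\<open>z0\<close> keeps the set nonempty when \<open>r = 0\<close>.\<close>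
  let ?I = "insert z0 (w ` {..<r})"
  have sub: "?I \<subseteq> Z" using w \<open>z0 \<in> Z\<close> by auto
  then obtain m where m: "m \<in> ?I" "\<forall>c\<in>?I. (c, m) \<in> omega1"
    using finite_max_omega1[of ?I] assms(2) by auto
  obtain i where i: "i < r" "R i m" using ex[of m] m(1) sub by blast
  have "(w i, m) \<in> omega1" using m(2) i(1) by simp
  then have "R i (w i)" using anti i(2) by blast
  with w[OF i(1)] show False by blast
qed

lemma mem_titer_supr:
  assumes "countable Z" "Z \<subseteq> Field omega1" "Z \<noteq> {}" "\<And>z. z \<in> Z \<Longrightarrow> x \<in> titer omega1 D P z"
  shows "x \<in> titer omega1 D P (wo_rel.supr omega1 Z)"
proof -
  obtain z where "z \<in> Z" using assms(3) by blast
  then have "x \<in> P" using assms(4) titer_subset[OF Well_order_omega1, of D P z] by blast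
  moreover have "x \<in> D (titer omega1 D P y)" if y: "y \<in> underS omega1 (wo_rel.supr omega1 Z)" for y
  proof -
    obtain z where "z \<in> Z" "y \<in> underS omega1 z"
      using underS_supr_omega1[OF assms(1,2) y] by blast
    then show ?thesis
      using assms(4) titer_underS_subset[OF Well_order_omega1, of y z D P] by blast
  qed
  ultimately show ?thesis by (subst titer_unfold[OF Well_order_omega1]) simp
qed

lemma ord_of_less: "b \<in> underS omega1 a \<Longrightarrow> ord_of b <o ord_of a"
proof -
  assume b: "b \<in> underS omega1 a"
  have "underS omega1 b \<subset> underS omega1 a"
    using b underS_trans_le_omega1[of b a] underS_imp_not_le_omega1[of b b]
    by (auto simp: underS_def)
  then show ?thesis
    unfolding ord_of_def
    using ofilter_subset_ordLess[OF Well_order_omega1] wo_rel.underS_ofilter[OF wo_rel_omega1] by blast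
qed

text \<open>Represents the multiples of an ordinal that do not exceed \<open>b\<close> by elements
  of \<open>omega1\<close>, so that their supremum can be formed there.\<close>

lemma ordLeq_ord_of_obtain:
  fixes s :: "'b rel"
  assumes "s \<le>o ord_of b" "b \<in> Field omega1"
  shows "\<exists>a. a \<in> Field omega1 \<and> (a, b) \<in> omega1 \<and> s =o ord_of a"
proof -
  have "ord_of b <o omega1"
    unfolding ord_of_def by (rule underS_Restr_ordLess[OF Well_order_omega1])
      (use assms(2) in auto)
  then have "s <o omega1" using assms(1) by (rule ordLeq_ordLess_trans[rotated])
  moreover have "Well_order s" using assms(1) by (auto simp: ordLeq_def)
  ultimately obtain a where a: "a \<in> Field omega1" "s =o ord_of a"
    using ordLess_iff_ordIso_Restr[OF Well_order_omega1] unfolding ord_of_def by blast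
  have "(a, b) \<in> omega1"
  proof (rule ccontr)
    assume "(a, b) \<notin> omega1"
    then have "ord_of b <o ord_of a" using a assms(2) by (intro ord_of_less not_le_omega1)
    then have "s <o ord_of a" using assms(1) by (rule ordLeq_ordLess_trans[rotated])
    then show False using a(2) not_ordLess_ordIso by blast
  qed
  with a show ?thesis by blast
qed

text \<open>The first copy of \<open>r\<close> is a proper initial segment, as it omits the points
  \<open>(x, 1)\<close>.\<close>

lemma ordLess_times_two:
  assumes r: "Well_order r" and "Field r \<noteq> {}"
  shows "r <o ord_times_nat r 2"
proof -
  let ?s = "ord_times_nat r 2"
  have "under ?s (x, 0) = (\<lambda>x. (x, 0)) ` under r x" if "x \<in> Field r" for x
    using that by (auto simp: under_def ord_times_nat_def Field_def)
  then have "embed r ?s (\<lambda>x. (x, 0))"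
    by (auto simp: embed_def bij_betw_def inj_on_def)
  moreover have "\<not> bij_betw (\<lambda>x. (x, 0)) (Field r) (Field ?s)"
  proof
    assume "bij_betw (\<lambda>x. (x, 0)) (Field r) (Field ?s)"
    then have "(\<lambda>x. (x, 0)) ` Field r = Field r \<times> {..<2 :: nat}"
      unfolding bij_betw_def Field_ord_times_nat[OF r] by simp
    moreover obtain x where "x \<in> Field r" using assms(2) by blast
    ultimately have "(x, 1) \<in> (\<lambda>x. (x, 0::nat)) ` Field r" by auto
    then show False by auto
  qed
  ultimately have "embedS r ?s (\<lambda>x. (x, 0))" by (simp add: embedS_def)
  then show ?thesis using r Well_order_ord_times_nat[OF r, of 2] unfolding ordLess_def by blast
qed

section \<open>The effect of a reduction on derivatives\<close>

lemma bder_comp_subset: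
  assumes "continuous_on UNIV k" "A \<subseteq> k -` B"
  shows "bder (g \<circ> k) q d A \<subseteq> k -` bder g q d B"
proof
  fix x assume x: "x \<in> bder (g \<circ> k) q d A"
  have "k x \<in> bder g q d B"
    unfolding bder_iff
  proof (intro conjI allI impI)
    show "k x \<in> B" using x assms(2) by (auto simp: bder_iff)
    fix U assume "open U" "k x \<in> U"
    then have "open (k -` U)" "x \<in> k -` U" using assms(1) by (auto intro: open_vimage)
    then have "(\<exists>y\<in>A \<inter> k -` U. q + d \<le> (g \<circ> k) y) \<and> (\<exists>y\<in>A \<inter> k -` U. (g \<circ> k) y \<le> q - d)"
      using x unfolding bder_iff by simp
    then show "\<exists>y\<in>B \<inter> U. q + d \<le> g y" "\<exists>y\<in>B \<inter> U. g y \<le> q - d"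
      using assms(2) by force+
  qed
  then show "x \<in> k -` bder g q d B" by simp
qed

lemma titer_bder_comp_subset:
  assumes "continuous_on UNIV k"
  shows "titer omega1 (bder (g \<circ> k) q d) UNIV a \<subseteq> k -` titer omega1 (bder g q d) UNIV a"
proof (induction a rule: Well_order_induct_underS[OF Well_order_omega1])
  case (1 a)
  have "bder (g \<circ> k) q d (titer omega1 (bder (g \<circ> k) q d) UNIV b)
      \<subseteq> k -` bder g q d (titer omega1 (bder g q d) UNIV b)" if "b \<in> underS omega1 a" for b
    by (rule bder_comp_subset[OF assms 1[OF that]])
  then show ?case
    unfolding titer_unfold[OF Well_order_omega1, of _ _ a] by (simp add: vimage_INT subset_iff)
qed

text \<open>At a point removed by all the derivatives on the right, each question about
  \<open>g\<close> has a constant correct bit nearby. On the intersection of these finitely many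
  neighbourhoods \<open>h\<close> gives a single bit correct for \<open>f\<close>, so
  \<open>f\<close> cannot reach both thresholds there.\<close>

lemma bder_subset_union:
  assumes tt: "\<And>A \<sigma>. length \<sigma> = r \<Longrightarrow>
      (\<And>i. i < r \<Longrightarrow> correct_answer (\<sigma> ! i) (g (k i A)) (q i) (d i)) \<Longrightarrow> correct_answer (h \<sigma>) (f A) p e"
  shows "bder f p e P \<subseteq> (\<Union>i<r. bder (g \<circ> k i) (q i) (d i) P)"
proof (rule subsetI, rule ccontr)
  fix x assume x: "x \<in> bder f p e P" and "x \<notin> (\<Union>i<r. bder (g \<circ> k i) (q i) (d i) P)"
  then have n: "x \<notin> bder (g \<circ> k i) (q i) (d i) P" if "i < r" for i using that by blast
  have "x \<in> P" using x by (simp add: bder_iff)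
  have "\<exists>U. open U \<and> x \<in> U \<and> (\<exists>b. \<forall>y\<in>P \<inter> U. correct_answer b (g (k i y)) (q i) (d i))"
    if i: "i < r" for i
  proof -
    have "\<not> (\<forall>U. open U \<longrightarrow> x \<in> U \<longrightarrow>
        (\<exists>y\<in>P \<inter> U. q i + d i \<le> g (k i y)) \<and> (\<exists>y\<in>P \<inter> U. g (k i y) \<le> q i - d i))"
      using n[OF i] \<open>x \<in> P\<close> unfolding bder_iff o_apply by simp
    then obtain U where U: "open U" "x \<in> U"
      "\<not> (\<exists>y\<in>P \<inter> U. q i + d i \<le> g (k i y)) \<or> \<not> (\<exists>y\<in>P \<inter> U. g (k i y) \<le> q i - d i)"
      by blast
    from U(3) have "\<exists>b. \<forall>y\<in>P \<inter> U. correct_answer b (g (k i y)) (q i) (d i)"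
    proof
      assume "\<not> (\<exists>y\<in>P \<inter> U. q i + d i \<le> g (k i y))"
      then show ?thesis by (intro exI[of _ True]) (simp add: correct_answer_def not_le)
    next
      assume "\<not> (\<exists>y\<in>P \<inter> U. g (k i y) \<le> q i - d i)"
      then show ?thesis by (intro exI[of _ False]) (simp add: correct_answer_def not_le)
    qed
    with U(1,2) show ?thesis by (intro exI[of _ U]) simp
  qed
  then obtain U where U: "\<And>i. i < r \<Longrightarrow> open (U i)" "\<And>i. i < r \<Longrightarrow> x \<in> U i"
    "\<And>i. i < r \<Longrightarrow> \<exists>b. \<forall>y\<in>P \<inter> U i. correct_answer b (g (k i y)) (q i) (d i)"
    by metis
  from U(3) obtain b
    where b: "\<And>i. i < r \<Longrightarrow> \<forall>y\<in>P \<inter> U i. correct_answer (b i) (g (k i y)) (q i) (d i)"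
    by metis
  let ?V = "\<Inter>i\<in>{..<r}. U i"
  have "open ?V" using U(1) by (intro open_INT) auto
  moreover have "x \<in> ?V" using U(2) by auto
  ultimately have V: "(\<exists>y\<in>P \<inter> ?V. p + e \<le> f y) \<and> (\<exists>y\<in>P \<inter> ?V. f y \<le> p - e)"
    using x unfolding bder_iff by simp
  have "correct_answer (h (map b [0..<r])) (f y) p e" if "y \<in> P \<inter> ?V" for y
  proof (rule tt)
    fix i assume "i < r"
    then show "correct_answer (map b [0..<r] ! i) (g (k i y)) (q i) (d i)"
      using b[of i] that by simp
  qed simp
  moreover obtain y y' where "y \<in> P \<inter> ?V" "p + e \<le> f y" "y' \<in> P \<inter> ?V" "f y' \<le> p - e"
    using V by (elim conjE bexE) (rule that)
  ultimately have "correct_answer (h (map b [0..<r])) (f y) p e"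
    "correct_answer (h (map b [0..<r])) (f y') p e" "p + e \<le> f y" "f y' \<le> p - e"
    by simp_all
  then show False by (simp add: correct_answer_def)
qed

lemma tt_reducible_imp_coarsening:
  assumes f: "baire1 f" and g: "baire1 g" "\<not> baire0 g" and tt: "tt_reducible f g"
  shows "ord_coarsening (bourgain_rank f) (bourgain_rank g)"
  unfolding ord_coarsening_def
proof
  fix c assume "c \<in> underS omega1 (bourgain_rank f)"
  then obtain p e where pe: "p \<in> \<rat>" "e \<in> \<rat>" "e > 0" and c: "titer omega1 (bder f p e) UNIV c \<noteq> {}"
    and "c \<in> Field omega1"
    unfolding underS_bourgain_rank[OF f] by blast
  have "p \<in> \<rat> \<and> e \<in> \<rat> \<and> e > 0" using pe by simp
  from tt[unfolded tt_reducible_def, THEN spec, THEN spec, THEN mp, OF this]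
  obtain r q d k h
    where qd': "\<forall>i<r. q i \<in> \<rat> \<and> d i \<in> \<rat> \<and> d i > 0 \<and> continuous_on UNIV (k i)"
    and corr': "\<forall>A \<sigma>. length \<sigma> = r \<and> (\<forall>i<r. correct_answer (\<sigma> ! i) (g (k i A)) (q i) (d i))
      \<longrightarrow> correct_answer (h \<sigma>) (f A) p e"
    by (elim exE conjE) (rule that)
  have qd: "q i \<in> \<rat> \<and> d i \<in> \<rat> \<and> d i > 0 \<and> continuous_on UNIV (k i)" if "i < r" for i
    using qd' that by simp
  have corr: "correct_answer (h \<sigma>) (f A) p e"
    if "length \<sigma> = r" "\<And>i. i < r \<Longrightarrow> correct_answer (\<sigma> ! i) (g (k i A)) (q i) (d i)" for A \<sigma>
    using corr' that by simp
  let ?w = omega1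
  let ?F = "bder f p e" and ?G = "\<lambda>i. bder (g \<circ> k i) (q i) (d i)"
  have FG: "?F P \<subseteq> (\<Union>i<r. ?G i P)" for P
    using corr by (rule bder_subset_union)

  \<comment> \<open>The ordinals 0 and 1\<close>
  obtain z where z: "z \<in> Field ?w" "underS ?w z = {}"
  proof -
    have "Field ?w \<noteq> {}" using uncountable_Field_omega1 by auto
    then have "wo_rel.minim ?w (Field ?w) \<in> Field ?w"
      by (intro wo_rel.minim_in[OF wo_rel_omega1]) auto
    moreover have "y \<notin> underS ?w (wo_rel.minim ?w (Field ?w))" for y
    proof
      assume y: "y \<in> underS ?w (wo_rel.minim ?w (Field ?w))"
      have "(wo_rel.minim ?w (Field ?w), y) \<in> ?w"
        by (rule wo_rel.minim_least[OF wo_rel_omega1]) (use underS_Field_omega1[OF y] in auto)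
      then show False using underS_imp_not_le_omega1[OF y] by blast
    qed
    ultimately show ?thesis using that by blast
  qed
  define one where "one = wo_rel.suc ?w {z}"
  have one: "one \<in> Field ?w" "underS ?w one = {z}"
    using suc_Field_omega1[OF z(1)] underS_suc_omega1[OF z(1)] z(2) by (auto simp: one_def)
  have titer_z: "titer ?w D P z = P" for D and P :: "cantor set"
    by (subst titer_unfold[OF Well_order_omega1]) (simp add: z(2))
  have titer_one: "titer ?w D P one = P \<inter> D P" for D and P :: "cantor set"
    by (subst titer_unfold[OF Well_order_omega1]) (simp add: one(2) titer_z)
  \<comment> \<open>Discontinuity of \<open>g\<close> enters here: some first derivative is
    nonempty.\<close>
  have one_less: "one \<in> underS ?w (bourgain_rank g)"
    unfolding underS_bourgain_rank[OF g(1)] titer_one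
    using exists_bder_UNIV_nonempty[OF g(2)] one(1) by simp

  \<comment> \<open>A common bound \<open>b\<close> for the stages of all questions\<close>
  have "\<exists>c. i < r \<longrightarrow> c \<in> underS ?w (bourgain_rank g) \<and> bder g (q i) (d i) (titer ?w (bder g (q i) (d i)) UNIV c) = {}"
    for i
  proof (cases "i < r")
    case True
    obtain c where "c \<in> Field ?w" "titer ?w (bder g (q i) (d i)) UNIV c \<noteq> {}"
      "bder g (q i) (d i) (titer ?w (bder g (q i) (d i)) UNIV c) = {}"
      using titer_bder_last[OF g(1), of "d i" "q i"] qd[OF True] by blast
    then show ?thesis
      unfolding underS_bourgain_rank[OF g(1)] using qd[OF True] by blast
  qed simp
  then obtain \<gamma> where \<gamma>: "\<And>i. i < r \<Longrightarrow> \<gamma> i \<in> underS ?w (bourgain_rank g)"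
    "\<And>i. i < r \<Longrightarrow> bder g (q i) (d i) (titer ?w (bder g (q i) (d i)) UNIV (\<gamma> i)) = {}"
    by metis
  \<comment> \<open>Including \<open>one\<close> provides a maximum when \<open>r = 0\<close> and
    ensures that \<open>b\<close> is at least 1, so that \<open>one\<close> is available in
    \<open>?Z\<close> below.\<close>
  let ?I = "insert one (\<gamma> ` {..<r})"
  have I: "?I \<subseteq> underS ?w (bourgain_rank g)" using one_less \<gamma>(1) by auto
  have I_Field: "?I \<subseteq> Field ?w"
  proof
    fix a assume "a \<in> ?I"
    then have "a \<in> underS ?w (bourgain_rank g)" using I by (rule subsetD[rotated])
    then show "a \<in> Field ?w" using underS_Field_omega1 by simp
  qed
  have "finite ?I" "?I \<noteq> {}" by simp_all
  from finite_max_omega1[OF this I_Field] obtain b where b: "b \<in> ?I" "\<forall>a\<in>?I. (a, b) \<in> ?w" ..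
  have b_less: "b \<in> underS ?w (bourgain_rank g)" using I b(1) by (rule subsetD)
  have b_Field: "b \<in> Field ?w" using I_Field b(1) by (rule subsetD)
  have kill: "?G i (titer ?w (?G i) UNIV b) = {}" if i: "i < r" for i
  proof -
    have "titer ?w (bder g (q i) (d i)) UNIV b \<subseteq> titer ?w (bder g (q i) (d i)) UNIV (\<gamma> i)"
      by (rule titer_antimono[OF Well_order_omega1]) (use b(2) i in simp)
    from optimal_derivative_mono[OF this, of "bourgain_family g (q i) (d i)"]
    have "bder g (q i) (d i) (titer ?w (bder g (q i) (d i)) UNIV b) = {}"
      unfolding \<gamma>(2)[OF i] by (rule subset_empty[THEN iffD1])
    moreover have "?G i (titer ?w (?G i) UNIV b)
        \<subseteq> k i -` bder g (q i) (d i) (titer ?w (bder g (q i) (d i)) UNIV b)"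
      using qd[OF i] by (intro bder_comp_subset titer_bder_comp_subset) auto
    ultimately show ?thesis by simp
  qed

  \<comment> \<open>All closed \<open>P\<close> are quantified over because the inclusion is applied
    repeatedly. Index 0 is excluded, since its multiples do not grow.\<close>
  define good where "good a \<longleftrightarrow> a \<in> Field ?w \<and> underS ?w a \<noteq> {} \<and>
    (\<forall>P. closed P \<longrightarrow> titer ?w ?F P a \<subseteq> (\<Union>i<r. titer ?w (?G i) P a))" for a
  \<comment> \<open>Used for \<kappa> and for the supremum of its multiples. The premise starts from
    membership at the supremum because in the second use a larger multiple for \<open>f\<close>
    yields a smaller one for \<open>g\<close>.\<close>
  have good_supr: "good (wo_rel.supr ?w Z)"
    if Z: "countable Z" "Z \<subseteq> Field ?w" "Z \<noteq> {}" and pos: "z0 \<in> Z" "underS ?w z0 \<noteq> {}"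
      and ex: "\<And>P a x. closed P \<Longrightarrow> a \<in> Z \<Longrightarrow> x \<in> titer ?w ?F P (wo_rel.supr ?w Z) \<Longrightarrow>
        \<exists>i<r. x \<in> titer ?w (?G i) P a" for Z z0
    unfolding good_def
  proof (intro conjI allI impI subsetI)
    show "wo_rel.supr ?w Z \<in> Field ?w" by (rule supr_omega1_Field[OF Z(1,2)])
    have "(z0, wo_rel.supr ?w Z) \<in> ?w" by (rule supr_omega1_upper[OF Z(1,2) pos(1)])
    then show "underS ?w (wo_rel.supr ?w Z) \<noteq> {}"
      using pos(2) underS_trans_le_omega1[of z0] by blast
    fix P x assume P: "closed P" and x: "x \<in> titer ?w ?F P (wo_rel.supr ?w Z)"
    have "\<exists>i<r. \<forall>a\<in>Z. x \<in> titer ?w (?G i) P a"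
    proof (rule finite_union_of_chains[OF Z(3,2)])
      show "x \<in> titer ?w (?G i) P a" if "(a, b) \<in> ?w" "x \<in> titer ?w (?G i) P b" for i a b
        using titer_antimono[OF Well_order_omega1 that(1)] that(2) by (rule subsetD)
      show "\<exists>i<r. x \<in> titer ?w (?G i) P a" if "a \<in> Z" for a
        by (rule ex[OF P that x])
    qed
    then obtain i where i: "i < r" "\<And>a. a \<in> Z \<Longrightarrow> x \<in> titer ?w (?G i) P a" by blast
    have "x \<in> titer ?w (?G i) P (wo_rel.supr ?w Z)"
      by (rule mem_titer_supr[OF Z i(2)])
    with i(1) show "x \<in> (\<Union>i<r. titer ?w (?G i) P (wo_rel.supr ?w Z))" by blast
  qed

  \<comment> \<open>The largest good ordinal \<kappa> up to \<open>b\<close> and its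
    multiples\<close>
  let ?Z = "{a. good a \<and> (a, b) \<in> ?w}"
  have "?Z \<subseteq> insert b (underS ?w b)" by (auto simp: underS_def)
  then have cZ: "countable ?Z"
    using countable_underS_omega1[OF b_Field] by (meson countable_insert countable_subset)
  have sZ: "?Z \<subseteq> Field ?w" by (auto simp: good_def)
  have "good one"
    unfolding good_def titer_one
  proof (intro conjI allI impI subsetI)
    fix P x assume "x \<in> P \<inter> ?F P"
    then have "x \<in> P" "x \<in> (\<Union>i<r. ?G i P)" using FG[of P] by auto
    then show "x \<in> (\<Union>i<r. P \<inter> ?G i P)" by simp
  qed (use one in auto)
  then have oZ: "one \<in> ?Z" using b(2) by simp
  define \<kappa> where "\<kappa> = wo_rel.supr ?w ?Z"
  have \<kappa>_upper: "(a, \<kappa>) \<in> ?w" if "a \<in> ?Z" for a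
    unfolding \<kappa>_def by (rule supr_omega1_upper[OF cZ sZ that])
  have \<kappa>_b: "(\<kappa>, b) \<in> ?w"
    unfolding \<kappa>_def by (rule supr_omega1_least[OF cZ sZ b_Field]) simp
  have "good \<kappa>"
    unfolding \<kappa>_def
  proof (rule good_supr[OF cZ sZ _ oZ])
    fix P a x assume P: "closed P" and a: "a \<in> ?Z" and x: "x \<in> titer ?w ?F P (wo_rel.supr ?w ?Z)"
    have "x \<in> titer ?w ?F P a"
      using titer_antimono[OF Well_order_omega1 \<kappa>_upper[OF a]] x unfolding \<kappa>_def by (rule subsetD)
    then show "\<exists>i<r. x \<in> titer ?w (?G i) P a" using a P by (auto simp: good_def)
  qed (use oZ one in auto)
  then have \<kappa>: "\<kappa> \<in> Field ?w" "underS ?w \<kappa> \<noteq> {}"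
    "\<And>P. closed P \<Longrightarrow> titer ?w ?F P \<kappa> \<subseteq> (\<Union>i<r. titer ?w (?G i) P \<kappa>)"
    by (auto simp: good_def)
  \<comment> \<open>The multiplicity argument, with the \<kappa>-th iterates in the roles of
    \<open>F\<close> and \<open>G i\<close>.\<close>
  have power: "((\<lambda>P. titer ?w ?F P \<kappa>) ^^ (r * m + 1)) P \<subseteq> (\<Union>i<r. ((\<lambda>P. titer ?w (?G i) P \<kappa>) ^^ m) P)"
    if "closed P" for m P
  proof (rule funpow_subset_union[OF _ _ _ _ _ _ that])
    show "titer ?w (?G i) A \<kappa> \<subseteq> titer ?w (?G i) B \<kappa>" if "A \<subseteq> B" for i A B
      by (rule titer_mono[OF Well_order_omega1 optimal_derivative_mono that])
    show "titer ?w ?F A \<kappa> \<inter> U \<subseteq> titer ?w ?F (A \<inter> U) \<kappa>" if "open U" for A U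
      by (intro titer_Int_local[OF Well_order_omega1] optimal_derivative_mono
          optimal_derivative_Int_open that)
  qed (simp_all add: closed_titer_bder titer_subset[OF Well_order_omega1] \<kappa>(3))

  \<comment> \<open>Otherwise all multiples of \<kappa> stay up to \<open>b\<close>. Their supremum
    is then good, at most \<open>b\<close> and strictly above \<kappa>, against the choice of
    \<kappa>.\<close>
  have "\<exists>m. ord_of b <o ord_times_nat (ord_of \<kappa>) m"
  proof (rule ccontr)
    assume no: "\<not> ?thesis"
    have "ord_times_nat (ord_of \<kappa>) m \<le>o ord_of b" for m
      using no not_ordLess_iff_ordLeq[OF Well_order_ord_times_nat[OF Well_order_ord_of] Well_order_ord_of]
      by blast
    then have "\<forall>m. \<exists>a. a \<in> Field ?w \<and> (a, b) \<in> ?w \<and> ord_times_nat (ord_of \<kappa>) m =o ord_of a"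
      using ordLeq_ord_of_obtain[OF _ b_Field] by blast
    then obtain u where u: "\<And>m. u m \<in> Field ?w" "\<And>m. (u m, b) \<in> ?w"
      "\<And>m. ord_times_nat (ord_of \<kappa>) m =o ord_of (u m)"
      by metis
    have titer_u: "titer ?w D P (u m) = ((\<lambda>P. titer ?w D P \<kappa>) ^^ m) P" for D m and P :: "cantor set"
      using Titer_ordIso[OF u(3)[of m], of D P] unfolding Titer_ord_of_times Titer_ord_of .
    have FO: "Field (ord_of \<kappa>) \<noteq> {}"
      using \<kappa>(2) unfolding ord_of_def
      by (simp add: Field_Restr_ofilter[OF Well_order_omega1] wo_rel.underS_ofilter[OF wo_rel_omega1])
    have \<kappa>_u: "\<kappa> \<in> underS ?w (u 2)"
    proof (rule ccontr)
      assume "\<kappa> \<notin> underS ?w (u 2)"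
      then have "(u 2, \<kappa>) \<in> ?w" using not_le_omega1[OF u(1) \<kappa>(1)] by blast
      then have "ord_of (u 2) \<le>o ord_of \<kappa>"
      proof (cases "u 2 = \<kappa>")
        case False
        then have "u 2 \<in> underS ?w \<kappa>" using \<open>(u 2, \<kappa>) \<in> ?w\<close> by (simp add: underS_def)
        then show ?thesis by (intro ordLess_imp_ordLeq ord_of_less)
      qed (simp add: ordLeq_reflexive[OF Well_order_ord_of])
      then have "ord_times_nat (ord_of \<kappa>) 2 \<le>o ord_of \<kappa>"
        by (rule ordIso_ordLeq_trans[OF u(3)])
      then show False
        using ordLess_times_two[OF Well_order_ord_of FO] not_ordLess_ordLeq by blast
    qed
    let ?L = "range u"
    have cL: "countable ?L" and sL: "?L \<subseteq> Field ?w" using u(1) by auto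
    have "good (wo_rel.supr ?w ?L)"
    proof (rule good_supr[OF cL sL, of "u 2"])
      show "underS ?w (u 2) \<noteq> {}" using \<kappa>_u by blast
      fix P a x assume P: "closed P" and "a \<in> ?L" and x: "x \<in> titer ?w ?F P (wo_rel.supr ?w ?L)"
      then obtain m where a: "a = u m" by blast
      \<comment> \<open>The supremum lies above the multiple \<open>r * m + 1\<close>, from which
        \<open>power\<close> leads to the multiple \<open>m\<close> for some
        \<open>i\<close>.\<close>
      have "(u (r * m + 1), wo_rel.supr ?w ?L) \<in> ?w"
        by (rule supr_omega1_upper[OF cL sL]) simp
      then have "x \<in> titer ?w ?F P (u (r * m + 1))"
        using x by (rule subsetD[OF titer_antimono[OF Well_order_omega1]])
      then have "x \<in> (\<Union>i<r. ((\<lambda>P. titer ?w (?G i) P \<kappa>) ^^ m) P)"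
        unfolding titer_u using power[OF P, of m] by (rule subsetD[rotated])
      then show "\<exists>i<r. x \<in> titer ?w (?G i) P a" unfolding a titer_u by blast
    qed auto
    moreover have "(wo_rel.supr ?w ?L, b) \<in> ?w"
      by (rule supr_omega1_least[OF cL sL b_Field]) (use u(2) in auto)
    ultimately have "(wo_rel.supr ?w ?L, \<kappa>) \<in> ?w" by (intro \<kappa>_upper) simp
    moreover have "(u 2, wo_rel.supr ?w ?L) \<in> ?w" by (rule supr_omega1_upper[OF cL sL]) simp
    then have "\<kappa> \<in> underS ?w (wo_rel.supr ?w ?L)" using \<kappa>_u by (rule underS_trans_le_omega1)
    ultimately show False using underS_imp_not_le_omega1 by blast
  qed
  then obtain m where m: "ord_of b <o ord_times_nat (ord_of \<kappa>) m" by blast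
  \<comment> \<open>Since \<kappa> is at most \<open>b\<close>, \<open>?N\<close> rounds with index
    \<open>b\<close> remove at least as much as \<open>?N\<close> rounds with index \<kappa>, to
    which \<open>power\<close> applies.\<close>
  let ?N = "r * m + 1"
  have step: "titer ?w ?F A b \<subseteq> titer ?w ?F B \<kappa>" if "A \<subseteq> B" for A B
  proof -
    have "titer ?w ?F A b \<subseteq> titer ?w ?F A \<kappa>" by (rule titer_antimono[OF Well_order_omega1 \<kappa>_b])
    also have "\<dots> \<subseteq> titer ?w ?F B \<kappa>"
      by (rule titer_mono[OF Well_order_omega1 optimal_derivative_mono that])
    finally show ?thesis .
  qed
  have "((\<lambda>P. titer ?w ?F P b) ^^ n) UNIV \<subseteq> ((\<lambda>P. titer ?w ?F P \<kappa>) ^^ n) UNIV" for n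
    by (induction n) (simp_all add: step)
  then have "((\<lambda>P. titer ?w ?F P b) ^^ ?N) UNIV \<subseteq> (\<Union>i<r. ((\<lambda>P. titer ?w (?G i) P \<kappa>) ^^ m) UNIV)"
    using power[OF closed_UNIV, of m] by (rule subset_trans)
  \<comment> \<open>The \<open>m\<close>-fold multiple of \<kappa> exceeds \<open>b\<close>, so this
    iterate lies in the derivative that \<open>kill\<close> shows to be empty.\<close>
  moreover have "((\<lambda>P. titer ?w (?G i) P \<kappa>) ^^ m) UNIV = {}" if "i < r" for i
    using Titer_ordLess[OF m, of "?G i" UNIV] kill[OF that]
    unfolding Titer_ord_of_times Titer_ord_of by simp
  ultimately have empty: "((\<lambda>P. titer ?w ?F P b) ^^ ?N) UNIV = {}" by auto
  \<comment> \<open>Otherwise the nonempty stage \<open>c\<close> of \<open>f\<close> would be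
    contained in the empty iterate.\<close>
  have "ord_of c <o ord_times_nat (ord_of b) ?N"
  proof (rule ccontr)
    assume "\<not> ?thesis"
    then have "ord_times_nat (ord_of b) ?N \<le>o ord_of c"
      using not_ordLess_iff_ordLeq[OF Well_order_ord_times_nat[OF Well_order_ord_of] Well_order_ord_of]
      by blast
    from Titer_ordLeq[OF this, of ?F UNIV] show False
      using c empty unfolding Titer_ord_of_times Titer_ord_of by simp
  qed
  with b_less show "\<exists>a\<in>underS ?w (bourgain_rank g). \<exists>n. ord_of c <o ord_times_nat (ord_of a) n"
    by blast
qed

theorem mainTheorem3:
  fixes f g :: "cantor \<Rightarrow> real"
  assumes "baire1 f" and "\<not> baire0 f"
    and "baire1 g" and "\<not> baire0 g"
  shows "tt_reducible f g \<longleftrightarrow> ord_coarsening (bourgain_rank f) (bourgain_rank g)"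
  using tt_reducible_imp_coarsening[OF assms(1,3,4)] coarsening_imp_tt_reducible[OF assms(1,3)]
  by (rule iffI)

end
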